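(* Let $n>1$, let $(w_i)_{i\in\mathbb{N}}$ be a sequence of elements of the free group $F_n$ on $x_1,\ldots,x_n$, let $(\alpha_i)_{i\in\mathbb{N}}$ be a sequence of positive integers, and let $G$ be the group defined by $$P=\langle x_1,\ldots,x_n \mid w_1^{\alpha_1},\ldots,w_m^{\alpha_m},\ldots\rangle .$$ Let $\psi:G\to\mathbb{Z}$ be a surjective homomorphism, and suppose there is a fixed natural number $K$ such that $\Delta_\psi(w_i)\le K$ for all $i\in\mathbb{N}$. If there is a prime number $p$ such that at most $n-2$ of the exponents $\alpha_i$ (counted by index $i\in\mathbb{N}$) are not divisible by $p$, then $G$ is large.
   Context: A finitely generated group is large if it has a finite index subgroup that surjects onto the non-abelian free group of rank $2$. Definition of $\Delta_\psi$: let $\varphi:F_n\to G$ be the canonical map induced by the presentation and put $\tilde\psi=\psi\circ\varphi:F_n\to\mathbb{Z}$. For a word $w=x_{i_1}^{k_1}x_{i_2}^{k_2}\cdots x_{i_l}^{k_l}$ in $F_n$ (reduced, written as a product of powers of generators, with consecutive generators distinct and non-zero exponents) and $1\le j\le l$, set $$\Delta_{\psi,j}(w)=k_1\tilde\psi(x_{i_1})+\cdots+k_j\tilde\psi(x_{i_j}),\qquad \Delta_\psi(w)=\max_{1\le j\le l}|\Delta_{\psi,j}(w)|,$$ with $\Delta_\psi(w)=0$ for the empty word. *)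

theory Defs
  imports "HOL-Algebra.Elementary_Groups" "HOL-Computational_Algebra.Primes"
begin

section \<open>Free groups\<close>

text \<open>
  The word \<open>[(x\<^sub>1, k\<^sub>1), \<dots>, (x\<^sub>l, k\<^sub>l)]\<close> stands for the product of powers
  \<open>x\<^sub>1\<^bsup>k\<^sub>1\<^esup> \<cdots> x\<^sub>l\<^bsup>k\<^sub>l\<^esup>\<close>.  The elements of the free group are the reduced words: all
  exponents are non-zero and consecutive generators are distinct.
\<close>

type_synonym 'a word = "('a \<times> int) list"

definition reduced :: "'a word \<Rightarrow> bool" where
  "reduced w \<longleftrightarrow> (\<forall>(x, k) \<in> set w. k \<noteq> 0) \<and> distinct_adj (map fst w)"

text \<open>Left multiplication of a reduced word by a single power of a generator.\<close>

fun power_cons :: "'a \<times> int \<Rightarrow> 'a word \<Rightarrow> 'a word" where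
  "power_cons (x, k) [] = (if k = 0 then [] else [(x, k)])"
| "power_cons (x, k) ((y, l) # w) =
     (if k = 0 then (y, l) # w
      else if x \<noteq> y then (x, k) # (y, l) # w
      else if k + l = 0 then w
      else (x, k + l) # w)"

definition word_mult :: "'a word \<Rightarrow> 'a word \<Rightarrow> 'a word" where
  "word_mult u v = foldr power_cons u v"

definition free_group :: "'a set \<Rightarrow> 'a word monoid" where
  "free_group X = \<lparr>carrier = {w. reduced w \<and> fst ` set w \<subseteq> X}, monoid.mult = word_mult, one = []\<rparr>"

definition free_gen :: "'a \<Rightarrow> 'a word" where
  "free_gen x = [(x, 1)]"

lemma reduced_Nil [simp]: "reduced []"
  by (simp add: reduced_def)

lemma reduced_Cons:
  "reduced ((x, k) # w) \<longleftrightarrow> k \<noteq> 0 \<and> reduced w \<and> (w = [] \<or> fst (hd w) \<noteq> x)"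
  by (cases w) (auto simp: reduced_def)

lemma reduced_power_cons: "reduced w \<Longrightarrow> reduced (power_cons s w)"
  by (cases "(s, w)" rule: power_cons.cases) (auto simp: reduced_Cons)

lemma power_cons_0 [simp]: "power_cons (x, 0) w = w"
  by (cases w) auto

lemma power_cons_power_cons:
  assumes "reduced w"
  shows "power_cons (x, k) (power_cons (x, l) w) = power_cons (x, k + l) w"
proof (cases w)
  case Nil
  then show ?thesis by auto
next
  case (Cons s v)
  obtain y m where s: "s = (y, m)" by (cases s)
  show ?thesis
  proof (cases v)
    case Nil
    with assms Cons s show ?thesis by (auto simp: reduced_def)
  next
    case (Cons t u)
    obtain z j where "t = (z, j)" by (cases t)
    with assms \<open>w = s # v\<close> s Cons show ?thesis
      by (auto simp: reduced_Cons)
  qed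
qed

lemma word_mult_Nil [simp]: "word_mult [] v = v"
  by (simp add: word_mult_def)

lemma word_mult_Cons [simp]: "word_mult (s # u) v = power_cons s (word_mult u v)"
  by (simp add: word_mult_def)

lemma word_mult_append: "word_mult (u @ u') v = word_mult u (word_mult u' v)"
  by (simp add: word_mult_def)

lemma reduced_word_mult: "reduced v \<Longrightarrow> reduced (word_mult u v)"
  by (induction u) (auto intro: reduced_power_cons)

lemma word_mult_power_cons:
  assumes "reduced v" "reduced w"
  shows "word_mult (power_cons s v) w = power_cons s (word_mult v w)"
proof -
  obtain x k where s: "s = (x, k)" by (cases s)
  show ?thesis
  proof (cases v)
    case Nil
    with s show ?thesis by auto
  next
    case (Cons t u)
    obtain y l where t: "t = (y, l)" by (cases t)
    have "reduced (word_mult u w)"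
      using assms(2) by (rule reduced_word_mult)
    from power_cons_power_cons[OF this] Cons s t show ?thesis by auto
  qed
qed

lemma word_mult_assoc:
  assumes "reduced v" "reduced w"
  shows "word_mult (word_mult u v) w = word_mult u (word_mult v w)"
  using assms by (induction u) (simp_all add: word_mult_power_cons reduced_word_mult)

lemma word_mult_Nil_right: "reduced u \<Longrightarrow> word_mult u [] = u"
proof (induction u)
  case (Cons s u)
  obtain x k where s: "s = (x, k)" by (cases s)
  with Cons have "word_mult (s # u) [] = power_cons (x, k) u"
    by (simp add: reduced_Cons)
  also have "\<dots> = s # u"
    using Cons.prems s by (cases u) (auto simp: reduced_Cons)
  finally show ?case .
qed simp

lemma word_mult_inverse:
  assumes "reduced w"
  shows "word_mult (rev (map (\<lambda>(x, k). (x, - k)) u)) (word_mult u w) = w"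
  using assms
proof (induction u arbitrary: w)
  case (Cons s u)
  obtain x k where "s = (x, k)" by (cases s)
  with Cons show ?case
    by (simp add: word_mult_append power_cons_power_cons reduced_word_mult)
qed simp

lemma letters_power_cons: "fst ` set (power_cons s w) \<subseteq> insert (fst s) (fst ` set w)"
  by (cases "(s, w)" rule: power_cons.cases) auto

lemma letters_word_mult: "fst ` set (word_mult u v) \<subseteq> fst ` set u \<union> fst ` set v"
proof (induction u)
  case (Cons s u)
  have "fst ` set (word_mult (s # u) v) \<subseteq> insert (fst s) (fst ` set (word_mult u v))"
    using letters_power_cons[of s] by simp
  also have "\<dots> \<subseteq> fst ` set (s # u) \<union> fst ` set v"
    using Cons.IH by (metis (no_types) image_insert insert_mono list.simps(15) Un_insert_left)
  finally show ?case .
qed simp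

lemma reduced_inverse:
  assumes "reduced w"
  shows "reduced (rev (map (\<lambda>(x, k). (x, - k)) w))"
proof -
  have "map fst (rev (map (\<lambda>(x, k). (x, - k)) w)) = rev (map fst w)"
    by (simp add: rev_map comp_def case_prod_beta)
  with assms show ?thesis
    unfolding reduced_def by (auto simp del: rev_map)
qed

theorem group_free_group: "group (free_group X)"
proof (rule groupI)
  fix u assume u: "u \<in> carrier (free_group X)"
  let ?v = "rev (map (\<lambda>(x, k). (x, - k)) u)"
  have "?v \<in> carrier (free_group X)"
    using u reduced_inverse[of u] by (auto simp: free_group_def)
  moreover have "word_mult ?v u = []"
    using word_mult_inverse[of "[]" u] word_mult_Nil_right[of u] u
    by (simp add: free_group_def)
  ultimately show "\<exists>v\<in>carrier (free_group X). v \<otimes>\<^bsub>free_group X\<^esub> u = \<one>\<^bsub>free_group X\<^esub>"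
    by (intro bexI[of _ ?v]) (simp_all add: free_group_def)
next
  fix u v assume "u \<in> carrier (free_group X)" "v \<in> carrier (free_group X)"
  then show "u \<otimes>\<^bsub>free_group X\<^esub> v \<in> carrier (free_group X)"
    using order_trans[OF letters_word_mult[of u v], of X]
    by (simp add: free_group_def reduced_word_mult)
qed (auto simp: free_group_def word_mult_assoc)


section \<open>Group presentations\<close>

definition normal_closure :: "('a, 'b) monoid_scheme \<Rightarrow> 'a set \<Rightarrow> 'a set" where
  "normal_closure G S =
     generate G {g \<otimes>\<^bsub>G\<^esub> s \<otimes>\<^bsub>G\<^esub> inv\<^bsub>G\<^esub> g | g s. g \<in> carrier G \<and> s \<in> S}"

definition presented_group :: "'a set \<Rightarrow> 'a word set \<Rightarrow> 'a word set monoid" where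
  "presented_group X R = free_group X Mod normal_closure (free_group X) R"

definition presentation_map :: "'a set \<Rightarrow> 'a word set \<Rightarrow> 'a word \<Rightarrow> 'a word set" where
  "presentation_map X R w = normal_closure (free_group X) R #>\<^bsub>free_group X\<^esub> w"

lemma (in group) normal_closure_normal:
  assumes "S \<subseteq> carrier G"
  shows "normal_closure G S \<lhd> G"
  unfolding normal_closure_def
proof (rule normal_generateI)
  fix h g assume "h \<in> {g \<otimes> s \<otimes> inv g | g s. g \<in> carrier G \<and> s \<in> S}" and g: "g \<in> carrier G"
  then obtain a s where a: "a \<in> carrier G" "s \<in> S" and h: "h = a \<otimes> s \<otimes> inv a" by blast
  have "g \<otimes> h \<otimes> inv g = (g \<otimes> a) \<otimes> s \<otimes> inv (g \<otimes> a)"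
    using g a assms unfolding h by (auto simp: m_assoc inv_mult_group)
  with g a show "g \<otimes> h \<otimes> inv g \<in> {g \<otimes> s \<otimes> inv g | g s. g \<in> carrier G \<and> s \<in> S}"
    by blast
qed (use assms in auto)

lemma group_presented_group:
  "R \<subseteq> carrier (free_group X) \<Longrightarrow> group (presented_group X R)"
  unfolding presented_group_def
  by (intro normal.factorgroup_is_group group.normal_closure_normal group_free_group)


section \<open>The quantity \<open>\<Delta>\<^sub>\<psi>\<close>\<close>

text \<open>Here \<open>f\<close> is the composite \<open>\<psi> \<circ> \<phi>\<close> on the free group.\<close>

definition Delta_partial :: "('a word \<Rightarrow> int) \<Rightarrow> nat \<Rightarrow> 'a word \<Rightarrow> int" where
  "Delta_partial f j w = (\<Sum>(x, k) \<leftarrow> take j w. k * f (free_gen x))"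

definition Delta :: "('a word \<Rightarrow> int) \<Rightarrow> 'a word \<Rightarrow> int" where
  "Delta f w = (if w = [] then 0 else Max ((\<lambda>j. \<bar>Delta_partial f j w\<bar>) ` {1..length w}))"


section \<open>Large groups\<close>

definition finitely_generated :: "('a, 'b) monoid_scheme \<Rightarrow> bool" where
  "finitely_generated G \<longleftrightarrow> (\<exists>S. finite S \<and> S \<subseteq> carrier G \<and> generate G S = carrier G)"

definition large :: "('a, 'b) monoid_scheme \<Rightarrow> bool" where
  "large G \<longleftrightarrow> group G \<and> finitely_generated G \<and>
     (\<exists>H. subgroup H G \<and> finite (rcosets\<^bsub>G\<^esub> H) \<and>
       (\<exists>f. f \<in> epi (G\<lparr>carrier := H\<rparr>) (free_group {1, 2 :: nat})))"

end

theory Submission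
  imports Defs "HOL-Algebra.Bij"
begin

text \<open>
  Write \<open>F\<close> for the free group on \<open>x\<^sub>1, \<dots>, x\<^sub>n\<close> and \<open>a x\<close> for the value of \<open>\<psi>\<close> on a generator
  \<open>x\<close>.  The integer \<open>height a w\<close>, the sum of the \<open>k * a x\<close> over the syllables \<open>x\<^sup>k\<close> of \<open>w\<close>, is the
  value of \<open>\<psi>\<close> on \<open>w\<close>.  It vanishes on every \<open>w\<^sub>i\<close>, because \<open>\<int>\<close> is torsion-free.  So, in the
  graph with vertex set \<open>\<int>\<close> and an edge from \<open>j\<close> to \<open>j + a x\<close> for each \<open>j\<close> and \<open>x\<close>, every \<open>w\<^sub>i\<close> is
  a closed path at each vertex, and the bound on \<open>\<Delta>\<^sub>\<psi>\<close> says that this path stays within distance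
  \<open>K\<close> of its starting point.

  Reduce the graph modulo a large number \<open>s\<close>.  It becomes a circle of \<open>s\<close> vertices, cut at a seam
  between \<open>s - 1\<close> and \<open>0\<close>.  A path \<open>w\<^sub>i\<close> either does not meet the seam, or remains in a
  neighbourhood of the seam whose size is independent of \<open>s\<close>.  Choose an integer weight
  \<open>c (j, x)\<close>, to be read modulo \<open>p\<close>, on every edge, such that the weights vanish near the seam and
  on all edges of one generator \<open>x\<^sub>0\<close> with \<open>a x\<^sub>0 \<noteq> 0\<close>, and such that the weights along \<open>w\<^sub>i\<close> sum to
  \<open>0\<close> modulo \<open>p\<close> whenever \<open>p\<close> does not divide \<open>\<alpha>\<^sub>i\<close>.  There are about \<open>(n - 1) s\<close> unknown weights and at
  most \<open>(n - 2) s\<close> linear conditions, so for large \<open>s\<close> some solution is non-zero modulo \<open>p\<close>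
  (\<open>nonzero_solution_mod\<close>).

  Now send a path to the sum of its weights modulo \<open>p\<close>, and record in addition every crossing of the
  seam by a letter \<open>t\<^sub>0\<close> or \<open>t\<^sub>1\<close>, according to whether the sum collected so far is zero or not.  Formally, \<open>F\<close>
  acts on \<open>{0..<s} \<times> {0..<p}\<close> with a cocycle into the free group on \<open>t\<^sub>0\<close> and \<open>t\<^sub>1\<close>.  A relator
  \<open>w\<^sub>i\<^bsup>\<alpha>\<^sub>i\<^esup>\<close> is invisible to this action (\<open>act_relator\<close>): near the seam its total number of crossings
  is zero and its weights vanish; away from the seam there are no crossings, and \<open>\<alpha>\<^sub>i\<close> times the sum of
  the weights along \<open>w\<^sub>i\<close> is divisible by \<open>p\<close>, since one of the two factors is.  Hence the action
  descends to \<open>G\<close>.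

  The stabilizer of a point has finite index in \<open>G\<close>, and the cocycle restricted to it is a
  homomorphism (\<open>finite_index_epi_if_hom_wreath\<close>).  It is onto (\<open>act_generators\<close>): going once around
  the circle along the weightless edges of \<open>x\<^sub>0\<close> yields \<open>t\<^sub>0\<close>, and conjugating this loop by a
  commutator of \<open>x\<close> with a power of \<open>x\<^sub>0\<close> that runs through an edge of non-zero weight yields \<open>t\<^sub>1\<close>.
\<close>

section \<open>Homomorphisms on free groups\<close>

definition word_value :: "('b, 'c) monoid_scheme \<Rightarrow> ('a \<Rightarrow> 'b) \<Rightarrow> 'a word \<Rightarrow> 'b" where
  "word_value T f w = foldr (\<lambda>(x, k) t. f x [^]\<^bsub>T\<^esub> k \<otimes>\<^bsub>T\<^esub> t) w \<one>\<^bsub>T\<^esub>"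

lemma word_value_Nil [simp]: "word_value T f [] = \<one>\<^bsub>T\<^esub>"
  by (simp add: word_value_def)

lemma word_value_Cons [simp]:
  "word_value T f ((x, k) # w) = f x [^]\<^bsub>T\<^esub> k \<otimes>\<^bsub>T\<^esub> word_value T f w"
  by (simp add: word_value_def)

lemma (in group) word_value_closed:
  assumes "f \<in> X \<rightarrow> carrier G" "fst ` set w \<subseteq> X"
  shows "word_value G f w \<in> carrier G"
  using assms(2)
proof (induction w)
  case (Cons s w)
  with assms(1) show ?case by (cases s) auto
qed simp

lemma (in group) word_value_power_cons:
  assumes "f \<in> X \<rightarrow> carrier G" "x \<in> X" "fst ` set w \<subseteq> X"
  shows "word_value G f (power_cons (x, k) w) = f x [^] k \<otimes> word_value G f w"
proof (cases w)
  case Nil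
  with assms show ?thesis by auto
next
  case (Cons t v)
  obtain y l where t: "t = (y, l)" by (cases t)
  have fx: "f x \<in> carrier G" and fy: "f y \<in> carrier G" and v: "word_value G f v \<in> carrier G"
    using assms t Cons word_value_closed[OF assms(1), of v] by auto
  have "f x [^] k \<otimes> (f x [^] l \<otimes> word_value G f v) = f x [^] (k + l) \<otimes> word_value G f v"
    using fx v by (simp add: int_pow_mult m_assoc)
  with fx fy v show ?thesis
    unfolding Cons t by auto
qed

lemma carrier_free_group:
  "w \<in> carrier (free_group X) \<longleftrightarrow> reduced w \<and> fst ` set w \<subseteq> X"
  by (simp add: free_group_def)

lemma one_free_group [simp]: "\<one>\<^bsub>free_group X\<^esub> = []"
  by (simp add: free_group_def)

lemma mult_free_group: "u \<otimes>\<^bsub>free_group X\<^esub> v = word_mult u v"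
  by (simp add: free_group_def)

text \<open>
  The universal property of the free group.  Word multiplication is an iteration of
  \<open>power_cons\<close>, so it is enough that a power of a generator in front may be merged with, or
  cancelled against, an equal generator, which is the law of exponents in the target.
\<close>

lemma (in group) word_value_hom:
  assumes "f \<in> X \<rightarrow> carrier G"
  shows "word_value G f \<in> hom (free_group X) G"
proof (rule homI)
  fix u v assume u: "u \<in> carrier (free_group X)" and v: "v \<in> carrier (free_group X)"
  have "fst ` set u \<subseteq> X" "fst ` set v \<subseteq> X"
    using u v by (simp_all add: carrier_free_group)
  then have "word_value G f (word_mult u v) = word_value G f u \<otimes> word_value G f v"
  proof (induction u)
    case Nil
    with word_value_closed[OF assms] show ?case by simp
  next
    case (Cons s u)
    obtain x k where s: "s = (x, k)" by (cases s)
    have x: "x \<in> X" "fst ` set u \<subseteq> X" "f x \<in> carrier G"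
      using Cons.prems(1) s assms by auto
    have "fst ` set (word_mult u v) \<subseteq> X"
      using letters_word_mult[of u v] x(2) Cons.prems(2) by blast
    with x Cons show ?case
      by (simp add: s word_value_power_cons[OF assms] m_assoc word_value_closed[OF assms])
  qed
  then show "word_value G f (u \<otimes>\<^bsub>free_group X\<^esub> v) = word_value G f u \<otimes> word_value G f v"
    by (simp add: mult_free_group)
qed (use word_value_closed[OF assms] in \<open>auto simp: carrier_free_group\<close>)

lemma free_gen_closed: "x \<in> X \<Longrightarrow> free_gen x \<in> carrier (free_group X)"
  by (simp add: carrier_free_group free_gen_def reduced_Cons)

lemma free_gen_int_pow:
  assumes "x \<in> X"
  shows "free_gen x [^]\<^bsub>free_group X\<^esub> (k :: int) = power_cons (x, k) []"
proof -
  interpret F: group "free_group X" by (rule group_free_group)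
  have *: "free_gen x [^]\<^bsub>free_group X\<^esub> (m :: nat) = power_cons (x, int m) []" for m
  proof (induction m)
    case (Suc m)
    have "free_gen x [^]\<^bsub>free_group X\<^esub> Suc m
        = free_gen x \<otimes>\<^bsub>free_group X\<^esub> free_gen x [^]\<^bsub>free_group X\<^esub> m"
      using assms free_gen_closed by (metis F.nat_pow_Suc2)
    also have "\<dots> = power_cons (x, 1) (power_cons (x, int m) [])"
      by (simp only: Suc) (simp add: mult_free_group free_gen_def)
    finally show ?case by (auto simp: algebra_simps)
  qed simp
  show ?thesis
  proof (cases "k \<ge> 0")
    case True
    then have "k = int (nat k)" by simp
    with *[of "nat k"] show ?thesis by (metis int_pow_int)
  next
    case False
    define m where "m = nat (- k)"
    have k: "k = - int m" using False by (simp add: m_def)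
    have c: "power_cons (x, l) [] \<in> carrier (free_group X)" for l
      using assms by (simp add: carrier_free_group reduced_Cons)
    have "power_cons (x, k) [] \<otimes>\<^bsub>free_group X\<^esub> free_gen x [^]\<^bsub>free_group X\<^esub> m = \<one>\<^bsub>free_group X\<^esub>"
      using False by (simp add: * mult_free_group k)
    then have "power_cons (x, k) [] = inv\<^bsub>free_group X\<^esub> (free_gen x [^]\<^bsub>free_group X\<^esub> m)"
      using c unfolding * by (intro F.inv_equality[symmetric])
    then show ?thesis
      using assms by (simp add: k F.int_pow_neg_int free_gen_closed)
  qed
qed

text \<open>
  The uniqueness half of the universal property: a reduced word is the product of its syllables
  in the free group itself.
\<close>

lemma hom_eq_word_value:
  assumes "group T" "h \<in> hom (free_group X) T" "w \<in> carrier (free_group X)"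
  shows "h w = word_value T (\<lambda>x. h (free_gen x)) w"
proof -
  interpret h: group_hom "free_group X" T h
    using assms group_free_group by (simp add: group_hom_def group_hom_axioms_def)
  from assms(3) show ?thesis
  proof (induction w)
    case Nil
    show ?case using h.hom_one by simp
  next
    case (Cons s w)
    obtain x k where s: "s = (x, k)" by (cases s)
    have x: "x \<in> X" "k \<noteq> 0" and w: "w \<in> carrier (free_group X)"
      using Cons.prems s by (auto simp: carrier_free_group reduced_Cons)
    have "s # w = word_mult [s] w"
      using Cons.prems s by (cases w) (auto simp: carrier_free_group reduced_Cons)
    also have "\<dots> = free_gen x [^]\<^bsub>free_group X\<^esub> k \<otimes>\<^bsub>free_group X\<^esub> w"
      using x s by (simp add: free_gen_int_pow mult_free_group)
    finally have "h (s # w) = h (free_gen x [^]\<^bsub>free_group X\<^esub> k) \<otimes>\<^bsub>T\<^esub> h w"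
      using h.hom_mult[OF h.G.int_pow_closed[OF free_gen_closed[OF x(1)]] w] by simp
    then show ?case
      using x free_gen_closed[of x X] Cons.IH[OF w] by (simp add: s h.hom_int_pow)
  qed
qed


lemma generate_free_gens:
  "generate (free_group X) (free_gen ` X) = carrier (free_group X)"
proof
  interpret F: group "free_group X" by (rule group_free_group)
  let ?H = "generate (free_group X) (free_gen ` X)"
  have gens: "free_gen ` X \<subseteq> carrier (free_group X)"
    by (rule image_subsetI) (rule free_gen_closed)
  then show "?H \<subseteq> carrier (free_group X)" by (rule F.generate_incl)
  have sub: "subgroup ?H (free_group X)"
    using gens by (rule F.generate_is_subgroup)
  have mem: "word_value (free_group X) free_gen w \<in> ?H" if "fst ` set w \<subseteq> X" for w
    using that
  proof (induction w)
    case (Cons s w)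
    obtain x k where s: "s = (x, k)" by (cases s)
    have "free_gen x \<in> ?H" using Cons.prems s by (auto intro: generate.incl)
    then have "free_gen x [^]\<^bsub>free_group X\<^esub> k \<in> ?H"
      using F.subgroup_int_pow_closed[OF sub] by blast
    with Cons s show ?case by (auto intro: generate.eng)
  qed (auto intro: generate.one[of "free_group X", simplified])
  show "carrier (free_group X) \<subseteq> ?H"
  proof
    fix w assume w: "w \<in> carrier (free_group X)"
    have "id \<in> hom (free_group X) (free_group X)" by (simp add: hom_def)
    from hom_eq_word_value[OF group_free_group this w] mem[of w] w show "w \<in> ?H"
      by (simp add: carrier_free_group)
  qed
qed

text \<open>
  With the universal property of quotients, this is what makes a homomorphism of the free group
  that kills the relators descend to the presented group.
\<close>

lemma (in group_hom) normal_closure_subset_kernel: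
  assumes "R \<subseteq> kernel G H h"
  shows "normal_closure G R \<subseteq> kernel G H h"
  unfolding normal_closure_def
proof (rule G.generate_subgroup_incl)
  show "subgroup (kernel G H h) G" by (rule subgroup_kernel)
  show "{g \<otimes>\<^bsub>G\<^esub> s \<otimes>\<^bsub>G\<^esub> inv\<^bsub>G\<^esub> g | g s. g \<in> carrier G \<and> s \<in> R} \<subseteq> kernel G H h"
    using assms by (force simp: kernel_def subset_iff)
qed

lemma presentation_map_hom:
  assumes "R \<subseteq> carrier (free_group X)"
  shows "presentation_map X R \<in> hom (free_group X) (presented_group X R)"
  using normal.r_coset_hom_Mod[OF group.normal_closure_normal[OF group_free_group assms]]
  by (simp add: presentation_map_def[abs_def] presented_group_def)

lemma carrier_presented_group:
  "carrier (presented_group X R) = presentation_map X R ` carrier (free_group X)"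
  by (auto simp: presented_group_def FactGroup_def RCOSETS_def presentation_map_def)

lemma presentation_map_relator:
  assumes "R \<subseteq> carrier (free_group X)" "r \<in> R"
  shows "presentation_map X R r = \<one>\<^bsub>presented_group X R\<^esub>"
proof -
  interpret F: group "free_group X" by (rule group_free_group)
  have r: "r \<in> carrier (free_group X)" using assms by blast
  have "r \<in> normal_closure (free_group X) R"
    unfolding normal_closure_def
  proof (rule generate.incl, intro CollectI exI conjI)
    show "r = \<one>\<^bsub>free_group X\<^esub> \<otimes>\<^bsub>free_group X\<^esub> r \<otimes>\<^bsub>free_group X\<^esub> inv\<^bsub>free_group X\<^esub> \<one>\<^bsub>free_group X\<^esub>"
      using r by (simp del: one_free_group)
  qed (use assms(2) F.one_closed in auto)
  moreover have "subgroup (normal_closure (free_group X) R) (free_group X)"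
    using F.normal_closure_normal[OF assms(1)] by (rule normal_imp_subgroup)
  ultimately show ?thesis
    using F.coset_join2[OF r] by (simp add: presentation_map_def presented_group_def)
qed

lemma finitely_generated_presented_group:
  assumes "finite X" "R \<subseteq> carrier (free_group X)"
  shows "finitely_generated (presented_group X R)"
proof -
  interpret q: group_hom "free_group X" "presented_group X R" "presentation_map X R"
    using group_free_group group_presented_group[OF assms(2)] presentation_map_hom[OF assms(2)]
    by (simp add: group_hom_def group_hom_axioms_def)
  have gens: "free_gen ` X \<subseteq> carrier (free_group X)"
    by (rule image_subsetI) (rule free_gen_closed)
  have "generate (presented_group X R) (presentation_map X R ` free_gen ` X)
      = carrier (presented_group X R)"
    using q.generate_img[OF gens] by (simp add: generate_free_gens carrier_presented_group)
  then show ?thesis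
    unfolding finitely_generated_def using assms(1) gens
    by (intro exI[of _ "presentation_map X R ` free_gen ` X"]) auto
qed

section \<open>Permutational wreath products\<close>

text \<open>
  The wreath product of \<open>F\<close> with the symmetric group on \<open>\<Omega>\<close>, realised as the permutations of
  \<open>\<Omega> \<times> F\<close> that commute with right multiplication by \<open>F\<close>.  A homomorphism into it amounts to an
  action on \<open>\<Omega>\<close> together with a cocycle with values in \<open>F\<close>.
\<close>

definition wreath :: "'o set \<Rightarrow> ('f, 'c) monoid_scheme \<Rightarrow> ('o \<times> 'f \<Rightarrow> 'o \<times> 'f) monoid" where
  "wreath \<Omega> F = BijGroup (\<Omega> \<times> carrier F)\<lparr>carrier :=
     {m \<in> Bij (\<Omega> \<times> carrier F). \<forall>\<omega>\<in>\<Omega>. \<forall>g\<in>carrier F. \<forall>h\<in>carrier F.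
        m (\<omega>, g \<otimes>\<^bsub>F\<^esub> h) = (fst (m (\<omega>, g)), snd (m (\<omega>, g)) \<otimes>\<^bsub>F\<^esub> h)}\<rparr>"

lemma wreath_one: "\<one>\<^bsub>wreath \<Omega> F\<^esub> = (\<lambda>x\<in>\<Omega> \<times> carrier F. x)"
  by (simp add: wreath_def BijGroup_def)

lemma wreath_carrier:
  "m \<in> carrier (wreath \<Omega> F) \<longleftrightarrow> m \<in> Bij (\<Omega> \<times> carrier F) \<and>
    (\<forall>\<omega>\<in>\<Omega>. \<forall>g\<in>carrier F. \<forall>h\<in>carrier F.
        m (\<omega>, g \<otimes>\<^bsub>F\<^esub> h) = (fst (m (\<omega>, g)), snd (m (\<omega>, g)) \<otimes>\<^bsub>F\<^esub> h))"
  by (simp add: wreath_def)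

lemma wreath_mult:
  assumes "m \<in> carrier (wreath \<Omega> F)" "m' \<in> carrier (wreath \<Omega> F)" "x \<in> \<Omega> \<times> carrier F"
  shows "(m \<otimes>\<^bsub>wreath \<Omega> F\<^esub> m') x = m (m' x)"
  using assms by (simp add: wreath_def BijGroup_def compose_def)

lemma wreath_apply_closed:
  assumes "m \<in> carrier (wreath \<Omega> F)" "x \<in> \<Omega> \<times> carrier F"
  shows "m x \<in> \<Omega> \<times> carrier F"
  using assms Bij_imp_funcset[of m] unfolding wreath_carrier by blast

text \<open>
  Only the closure under inverses needs an argument: if \<open>m\<close> maps \<open>(\<omega>', g')\<close> to \<open>(\<omega>, g)\<close>, then by
  equivariance it maps \<open>(\<omega>', g' h)\<close> to \<open>(\<omega>, g h)\<close>.
\<close>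

lemma group_wreath:
  assumes "group F"
  shows "group (wreath \<Omega> F)"
proof -
  interpret F: group F by fact
  let ?S = "\<Omega> \<times> carrier F"
  interpret B: group "BijGroup ?S" by (rule group_BijGroup)
  let ?C = "carrier (wreath \<Omega> F)"
  have "subgroup ?C (BijGroup ?S)"
  proof (rule B.subgroupI)
    show "?C \<subseteq> carrier (BijGroup ?S)" by (auto simp: wreath_carrier BijGroup_def)
    have "\<one>\<^bsub>BijGroup ?S\<^esub> \<in> ?C" by (simp add: wreath_carrier BijGroup_def id_Bij)
    then show "?C \<noteq> {}" by blast
  next
    fix m assume m: "m \<in> ?C"
    define n where "n = inv\<^bsub>BijGroup ?S\<^esub> m"
    have mB: "m \<in> carrier (BijGroup ?S)" using m by (simp add: wreath_carrier BijGroup_def)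
    then have nB: "n \<in> carrier (BijGroup ?S)" by (simp add: n_def)
    have Bij: "m \<in> Bij ?S" "n \<in> Bij ?S"
      using mB nB by (simp_all add: BijGroup_def)
    note fs = Bij[THEN Bij_imp_funcset]
    have nm: "n (m x) = x" if "x \<in> ?S" for x
    proof -
      have "n \<otimes>\<^bsub>BijGroup ?S\<^esub> m = \<one>\<^bsub>BijGroup ?S\<^esub>"
        using mB by (simp add: n_def)
      then have "compose ?S n m = (\<lambda>x\<in>?S. x)"
        using Bij by (simp add: BijGroup_def)
      from fun_cong[OF this, of x] that show ?thesis by (simp add: compose_def)
    qed
    have mn: "m (n x) = x" if "x \<in> ?S" for x
    proof -
      have "m \<otimes>\<^bsub>BijGroup ?S\<^esub> n = \<one>\<^bsub>BijGroup ?S\<^esub>"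
        using mB by (simp add: n_def)
      then have "compose ?S m n = (\<lambda>x\<in>?S. x)"
        using Bij by (simp add: BijGroup_def)
      from fun_cong[OF this, of x] that show ?thesis by (simp add: compose_def)
    qed
    have "n (\<omega>, g \<otimes>\<^bsub>F\<^esub> h) = (fst (n (\<omega>, g)), snd (n (\<omega>, g)) \<otimes>\<^bsub>F\<^esub> h)"
      if \<omega>: "\<omega> \<in> \<Omega>" and g: "g \<in> carrier F" and h: "h \<in> carrier F" for \<omega> g h
    proof -
      obtain \<omega>' g' where n: "n (\<omega>, g) = (\<omega>', g')" by (cases "n (\<omega>, g)")
      then have c: "\<omega>' \<in> \<Omega>" "g' \<in> carrier F" using funcset_mem[OF fs(2), of "(\<omega>, g)"] \<omega> g by simp_all
      have "m (\<omega>', g') = (\<omega>, g)" using mn[of "(\<omega>, g)"] n \<omega> g by simp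
      then have "m (\<omega>', g' \<otimes>\<^bsub>F\<^esub> h) = (\<omega>, g \<otimes>\<^bsub>F\<^esub> h)" using m c h by (simp add: wreath_carrier)
      then show ?thesis using nm[of "(\<omega>', g' \<otimes>\<^bsub>F\<^esub> h)"] n c h by simp
    qed
    with Bij(2) show "inv\<^bsub>BijGroup ?S\<^esub> m \<in> ?C"
      unfolding n_def[symmetric] wreath_carrier by blast
  next
    fix m m' assume m: "m \<in> ?C" "m' \<in> ?C"
    then have B: "m \<in> Bij ?S" "m' \<in> Bij ?S" by (simp_all add: wreath_carrier)
    have "m (m' (\<omega>, g \<otimes>\<^bsub>F\<^esub> h)) = (fst (m (m' (\<omega>, g))), snd (m (m' (\<omega>, g))) \<otimes>\<^bsub>F\<^esub> h)"
      if "\<omega> \<in> \<Omega>" "g \<in> carrier F" "h \<in> carrier F" for \<omega> g h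
    proof -
      have "m' (\<omega>, g) \<in> ?S" using wreath_apply_closed[OF m(2)] that by blast
      then show ?thesis using m that
        by (cases "m' (\<omega>, g)") (auto simp: wreath_carrier)
    qed
    then show "m \<otimes>\<^bsub>BijGroup ?S\<^esub> m' \<in> ?C"
      using B by (simp add: wreath_carrier BijGroup_def compose_Bij) (simp add: compose_def)
  qed
  then show ?thesis
    using B.subgroup_imp_group by (simp add: wreath_def)
qed

text \<open>
  The stabilizer \<open>H\<close> of the fibre over \<open>\<omega>\<close> has finite index because \<open>\<Omega>\<close> is finite.  By equivariance
  an element of \<open>H\<close> acts on this fibre, a copy of \<open>F\<close>, by left multiplication with a
  single element \<open>\<kappa>\<close> of \<open>F\<close>, and \<open>\<kappa>\<close> is a homomorphism.  To see that it is onto, it suffices to reach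
  the generators of \<open>F\<close> from the neutral element of the fibre.
\<close>

lemma finite_index_epi_if_hom_wreath:
  fixes G (structure) and F (structure)
  assumes "group G" "group F" "finite \<Omega>"
    and \<theta>: "\<theta> \<in> hom G (wreath \<Omega> F)"
    and \<omega>: "\<omega> \<in> \<Omega>"
    and Y: "generate F Y = carrier F"
    and gens: "\<And>y. y \<in> Y \<Longrightarrow> \<exists>g\<in>carrier G. \<theta> g (\<omega>, \<one>\<^bsub>F\<^esub>) = (\<omega>, y)"
  shows "\<exists>H. subgroup H G \<and> finite (rcosets\<^bsub>G\<^esub> H) \<and> (\<exists>f. f \<in> epi (G\<lparr>carrier := H\<rparr>) F)"
proof -
  let ?W = "wreath \<Omega> F" and ?S = "\<Omega> \<times> carrier F"
  interpret G: group G by fact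
  interpret F: group F by fact
  interpret \<theta>: group_hom G ?W \<theta>
    using \<theta> group_wreath[OF F.is_group] by (simp add: group_hom_def group_hom_axioms_def \<open>group G\<close>)
  have e: "(\<omega>', \<one>\<^bsub>F\<^esub>) \<in> ?S" if "\<omega>' \<in> \<Omega>" for \<omega>' using that F.one_closed by simp
  have closed: "\<theta> g x \<in> ?S" if "g \<in> carrier G" "x \<in> ?S" for g x
    using wreath_apply_closed[OF \<theta>.hom_closed] that by blast
  have mult: "\<theta> (g \<otimes>\<^bsub>G\<^esub> h) x = \<theta> g (\<theta> h x)" if "g \<in> carrier G" "h \<in> carrier G" "x \<in> ?S" for g h x
    using that by (simp add: wreath_mult)
  have equi: "\<theta> g (\<omega>', a) = (fst (\<theta> g (\<omega>', \<one>\<^bsub>F\<^esub>)), snd (\<theta> g (\<omega>', \<one>\<^bsub>F\<^esub>)) \<otimes>\<^bsub>F\<^esub> a)"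
    if "g \<in> carrier G" "\<omega>' \<in> \<Omega>" "a \<in> carrier F" for g \<omega>' a
  proof -
    have "\<theta> g (\<omega>', \<one>\<^bsub>F\<^esub> \<otimes>\<^bsub>F\<^esub> a) = (fst (\<theta> g (\<omega>', \<one>\<^bsub>F\<^esub>)), snd (\<theta> g (\<omega>', \<one>\<^bsub>F\<^esub>)) \<otimes>\<^bsub>F\<^esub> a)"
      using \<theta>.hom_closed[OF that(1)] that F.one_closed unfolding wreath_carrier by blast
    then show ?thesis using that F.l_one[of a] by simp
  qed
  have one: "\<theta> \<one>\<^bsub>G\<^esub> x = x" if "x \<in> ?S" for x using that by (simp add: wreath_one)
  define H where "H = {g \<in> carrier G. fst (\<theta> g (\<omega>, \<one>\<^bsub>F\<^esub>)) = \<omega>}"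
  define \<kappa> where "\<kappa> g = snd (\<theta> g (\<omega>, \<one>\<^bsub>F\<^esub>))" for g
  have HD: "\<theta> g (\<omega>, a) = (\<omega>, \<kappa> g \<otimes>\<^bsub>F\<^esub> a)" "\<kappa> g \<in> carrier F" "g \<in> carrier G"
    if "g \<in> H" "a \<in> carrier F" for g a
    using that equi[of g \<omega> a] closed[of g "(\<omega>, \<one>\<^bsub>F\<^esub>)"] e \<omega>
    by (auto simp: H_def \<kappa>_def mem_Times_iff)
  have HI: "g \<in> H" if "g \<in> carrier G" "\<theta> g (\<omega>, a) = (\<omega>, b)" "a \<in> carrier F" for g a b
    using that equi[of g \<omega> a] \<omega> by (simp add: H_def)
  have sub: "subgroup H G"
  proof (rule G.subgroupI)
    show "H \<subseteq> carrier G" by (auto simp: H_def)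
    show "H \<noteq> {}" using one[of "(\<omega>, \<one>\<^bsub>F\<^esub>)"] e[OF \<omega>] by (force simp: H_def)
  next
    fix g assume g: "g \<in> H"
    note g' = HD[OF g F.one_closed]
    have "\<theta> (inv\<^bsub>G\<^esub> g) (\<theta> g (\<omega>, \<one>\<^bsub>F\<^esub>)) = (\<omega>, \<one>\<^bsub>F\<^esub>)"
      using mult[of "inv\<^bsub>G\<^esub> g" g "(\<omega>, \<one>\<^bsub>F\<^esub>)"] one e[OF \<omega>] g' by simp
    then show "inv\<^bsub>G\<^esub> g \<in> H"
      using g' HI[of "inv\<^bsub>G\<^esub> g" "\<kappa> g"] by simp
  next
    fix g h assume g: "g \<in> H" and h: "h \<in> H"
    note g' = HD(3)[OF g F.one_closed] and h' = HD[OF h F.one_closed]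
    have "\<theta> (g \<otimes>\<^bsub>G\<^esub> h) (\<omega>, \<one>\<^bsub>F\<^esub>) = (\<omega>, \<kappa> g \<otimes>\<^bsub>F\<^esub> \<kappa> h)"
      using mult[of g h "(\<omega>, \<one>\<^bsub>F\<^esub>)"] e[OF \<omega>] g' h' HD(1)[OF g h'(2)] by simp
    then show "g \<otimes>\<^bsub>G\<^esub> h \<in> H" using g' h' HI[of "g \<otimes>\<^bsub>G\<^esub> h" "\<one>\<^bsub>F\<^esub>"] F.one_closed by simp
  qed
  have \<kappa>: "\<kappa> \<in> hom (G\<lparr>carrier := H\<rparr>) F"
  proof (rule homI)
    fix g assume "g \<in> carrier (G\<lparr>carrier := H\<rparr>)"
    then show "\<kappa> g \<in> carrier F" using HD(2)[OF _ F.one_closed] by simp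
  next
    fix g h assume "g \<in> carrier (G\<lparr>carrier := H\<rparr>)" "h \<in> carrier (G\<lparr>carrier := H\<rparr>)"
    then have g: "g \<in> H" and h: "h \<in> H" by auto
    note g' = HD(3)[OF g F.one_closed] and h' = HD[OF h F.one_closed]
    have "\<theta> (g \<otimes>\<^bsub>G\<^esub> h) (\<omega>, \<one>\<^bsub>F\<^esub>) = (\<omega>, \<kappa> g \<otimes>\<^bsub>F\<^esub> \<kappa> h)"
      using mult[of g h "(\<omega>, \<one>\<^bsub>F\<^esub>)"] e[OF \<omega>] g' h' HD(1)[OF g h'(2)] by simp
    then show "\<kappa> (g \<otimes>\<^bsub>G\<lparr>carrier := H\<rparr>\<^esub> h) = \<kappa> g \<otimes>\<^bsub>F\<^esub> \<kappa> h"
      by (simp add: \<kappa>_def)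
  qed
  interpret \<kappa>: group_hom "G\<lparr>carrier := H\<rparr>" F \<kappa>
    using \<kappa> G.subgroup_imp_group[OF sub] F.is_group by (simp add: group_hom_def group_hom_axioms_def)
  have "Y \<subseteq> \<kappa> ` H"
  proof
    fix y assume "y \<in> Y"
    with gens obtain g where "g \<in> carrier G" "\<theta> g (\<omega>, \<one>\<^bsub>F\<^esub>) = (\<omega>, y)" by blast
    then show "y \<in> \<kappa> ` H" by (force simp: H_def \<kappa>_def)
  qed
  then have "carrier F \<subseteq> \<kappa> ` H"
    using F.generate_subgroup_incl[of Y, OF _ \<kappa>.img_is_subgroup] Y by simp
  then have epi: "\<kappa> \<in> epi (G\<lparr>carrier := H\<rparr>) F"
    using \<kappa> by (simp add: epi_iff_subset)
  \<comment> \<open>The right coset \<open>H g\<close> corresponds to the point \<open>g\<^sup>-\<^sup>1 \<omega>\<close>, which does not depend on the choice of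
     \<open>g\<close>; it would be \<open>g \<omega>\<close> for left cosets.\<close>
  define pt where "pt g = fst (\<theta> (inv\<^bsub>G\<^esub> g) (\<omega>, \<one>\<^bsub>F\<^esub>))" for g
  have coset_eq: "H #>\<^bsub>G\<^esub> g = H #>\<^bsub>G\<^esub> h"
    if g: "g \<in> carrier G" and h: "h \<in> carrier G" and gh: "pt g = pt h" for g h
  proof -
    define a where "a = snd (\<theta> (inv\<^bsub>G\<^esub> g) (\<omega>, \<one>\<^bsub>F\<^esub>))"
    define b where "b = snd (\<theta> (inv\<^bsub>G\<^esub> h) (\<omega>, \<one>\<^bsub>F\<^esub>))"
    have ab: "\<theta> (inv\<^bsub>G\<^esub> g) (\<omega>, \<one>\<^bsub>F\<^esub>) = (pt h, a)" "\<theta> (inv\<^bsub>G\<^esub> h) (\<omega>, \<one>\<^bsub>F\<^esub>) = (pt h, b)"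
      using gh by (simp_all add: a_def b_def pt_def prod_eq_iff)
    have c: "pt h \<in> \<Omega>" "a \<in> carrier F" "b \<in> carrier F"
      using closed[OF G.inv_closed[OF g] e[OF \<omega>]] closed[OF G.inv_closed[OF h] e[OF \<omega>]] ab
      by simp_all
    have "\<theta> h (pt h, b) = (\<omega>, \<one>\<^bsub>F\<^esub>)"
      using mult[of h "inv\<^bsub>G\<^esub> h" "(\<omega>, \<one>\<^bsub>F\<^esub>)"] h e[OF \<omega>] one ab by simp
    then have "fst (\<theta> h (pt h, a)) = \<omega>"
      using equi[OF h c(1,2)] equi[OF h c(1,3)] by simp
    then have "h \<otimes>\<^bsub>G\<^esub> inv\<^bsub>G\<^esub> g \<in> H"
      using mult[of h "inv\<^bsub>G\<^esub> g" "(\<omega>, \<one>\<^bsub>F\<^esub>)"] g h e[OF \<omega>] ab by (simp add: H_def)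
    then have "h \<in> H #>\<^bsub>G\<^esub> g"
      using g h subgroup.rcos_module_rev[OF sub G.is_group] by blast
    then show ?thesis using G.repr_independence[OF _ g sub] by blast
  qed
  have "finite (rcosets\<^bsub>G\<^esub> H)"
  proof (rule finite_surj)
    show "finite \<Omega>" by fact
    show "rcosets\<^bsub>G\<^esub> H \<subseteq> (\<lambda>\<omega>'. H #>\<^bsub>G\<^esub> (SOME g. g \<in> carrier G \<and> pt g = \<omega>')) ` \<Omega>"
    proof
      fix C assume "C \<in> rcosets\<^bsub>G\<^esub> H"
      then obtain g where g: "g \<in> carrier G" and C: "C = H #>\<^bsub>G\<^esub> g" by (auto simp: RCOSETS_def)
      define h where "h = (SOME h. h \<in> carrier G \<and> pt h = pt g)"
      have "h \<in> carrier G \<and> pt h = pt g"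
        unfolding h_def by (rule someI[of _ g]) (use g in simp)
      then have "C = H #>\<^bsub>G\<^esub> h" using coset_eq g C by metis
      moreover have "pt g \<in> \<Omega>"
        using closed[OF G.inv_closed[OF g] e[OF \<omega>]] by (simp add: pt_def mem_Times_iff)
      ultimately show "C \<in> (\<lambda>\<omega>'. H #>\<^bsub>G\<^esub> (SOME g. g \<in> carrier G \<and> pt g = \<omega>')) ` \<Omega>"
        unfolding h_def by (rule image_eqI)
    qed
  qed
  with sub epi show ?thesis by blast
qed

section \<open>Heights and sums along paths\<close>

definition height :: "('a \<Rightarrow> int) \<Rightarrow> 'a word \<Rightarrow> int" where
  "height a w = (\<Sum>(x, k) \<leftarrow> w. k * a x)"

lemma height_simps [simp]:
  "height a [] = 0"
  "height a ((x, k) # w) = k * a x + height a w"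
  "height a (u @ v) = height a u + height a v"
  by (simp_all add: height_def)

text \<open>
  The sum of the weights \<open>d\<close> along a path of \<open>k\<close> steps of length \<open>b\<close> that starts at \<open>j\<close>.  The step
  from \<open>i\<close> to \<open>i + b\<close> has weight \<open>d i\<close>; for negative \<open>k\<close> the path runs backwards through the
  steps that lead from \<open>j + k * b\<close> up to \<open>j\<close>, and they count negatively.
\<close>

definition power_sum :: "int \<Rightarrow> (int \<Rightarrow> int) \<Rightarrow> int \<Rightarrow> int \<Rightarrow> int" where
  "power_sum b d j k =
     (if k \<ge> 0 then \<Sum>i<nat k. d (j + int i * b)
      else - (\<Sum>i<nat (- k). d (j + k * b + int i * b)))"

text \<open>
  Groups act from the left here, so the path of a word starts with its last syllable.
\<close>

fun path_sum :: "('a \<Rightarrow> int) \<Rightarrow> (int \<times> 'a \<Rightarrow> int) \<Rightarrow> int \<Rightarrow> 'a word \<Rightarrow> int" where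
  "path_sum a c j [] = 0"
| "path_sum a c j ((x, k) # w) =
     path_sum a c j w + power_sum (a x) (\<lambda>i. c (i, x)) (j + height a w) k"

text \<open>
  Linearity in the weights is what allows the weights to be found by linear algebra.
\<close>

lemma path_sum_diff:
  "path_sum a (\<lambda>e. c e - c' e) j w = path_sum a c j w - path_sum a c' j w"
  by (induction w) (auto simp: power_sum_def sum_subtractf)

lemma power_sum_0 [simp]: "power_sum b (\<lambda>i. 0) j k = 0"
  by (simp add: power_sum_def)

text \<open>
  A family of states \<open>st j \<zeta>\<close> with position \<open>j\<close> and accumulated weight \<open>\<zeta>\<close> is given, on which
  \<open>\<gamma>\<close> makes the expected single step as long as the position stays in a window \<open>W\<close>.  The window is
  convex, so a path of equal steps stays inside as soon as its two ends do; this is why it is enough to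
  control the heights of words at the ends of their syllables.
\<close>

lemma wreath_nat_pow_transport:
  fixes W :: "int set" and n :: nat
  assumes F: "group F" and \<gamma>: "\<gamma> \<in> carrier (wreath \<Omega> F)"
    and conv: "\<And>i j k. i \<in> W \<Longrightarrow> k \<in> W \<Longrightarrow> i \<le> j \<Longrightarrow> j \<le> k \<Longrightarrow> j \<in> W"
    and st: "\<And>j \<zeta>. j \<in> W \<Longrightarrow> st j \<zeta> \<in> \<Omega> \<times> carrier F"
    and step: "\<And>j \<zeta>. j \<in> W \<Longrightarrow> j + b \<in> W \<Longrightarrow> \<gamma> (st j \<zeta>) = st (j + b) (\<zeta> + d j)"
    and j: "j \<in> W" "j + int n * b \<in> W"
  shows "(\<gamma> [^]\<^bsub>wreath \<Omega> F\<^esub> n) (st j \<zeta>) = st (j + int n * b) (\<zeta> + (\<Sum>i<n. d (j + int i * b)))"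
  using j(2)
proof (induction n)
  case 0
  show ?case using st[OF j(1)] by (simp add: wreath_one)
next
  case (Suc n)
  interpret T: group "wreath \<Omega> F" using F by (rule group_wreath)
  have mem: "j + int n * b \<in> W"
  proof (cases "b \<ge> 0")
    case True
    then show ?thesis by (intro conv[OF j(1) Suc.prems]) (simp_all add: algebra_simps)
  next
    case False
    then show ?thesis by (intro conv[OF Suc.prems j(1)]) (simp_all add: algebra_simps mult_nonpos_nonneg)
  qed
  have next_eq: "j + int n * b + b = j + int (Suc n) * b" by (simp add: algebra_simps)
  have "(\<gamma> [^]\<^bsub>wreath \<Omega> F\<^esub> Suc n) (st j \<zeta>) = \<gamma> ((\<gamma> [^]\<^bsub>wreath \<Omega> F\<^esub> n) (st j \<zeta>))"
    using T.nat_pow_Suc2[OF \<gamma>, of n] wreath_mult[OF \<gamma> T.nat_pow_closed[OF \<gamma>] st[OF j(1)]] by simp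
  also have "\<dots> = st (j + int (Suc n) * b) (\<zeta> + (\<Sum>i<n. d (j + int i * b)) + d (j + int n * b))"
    using step[OF mem] Suc.prems unfolding Suc.IH[OF mem] next_eq by simp
  finally show ?case by (simp add: algebra_simps)
qed

lemma wreath_int_pow_transport:
  fixes W :: "int set" and k :: int
  assumes F: "group F" and \<gamma>: "\<gamma> \<in> carrier (wreath \<Omega> F)"
    and conv: "\<And>i j k. i \<in> W \<Longrightarrow> k \<in> W \<Longrightarrow> i \<le> j \<Longrightarrow> j \<le> k \<Longrightarrow> j \<in> W"
    and st: "\<And>j \<zeta>. j \<in> W \<Longrightarrow> st j \<zeta> \<in> \<Omega> \<times> carrier F"
    and step: "\<And>j \<zeta>. j \<in> W \<Longrightarrow> j + b \<in> W \<Longrightarrow> \<gamma> (st j \<zeta>) = st (j + b) (\<zeta> + d j)"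
    and j: "j \<in> W" "j + k * b \<in> W"
  shows "(\<gamma> [^]\<^bsub>wreath \<Omega> F\<^esub> k) (st j \<zeta>) = st (j + k * b) (\<zeta> + power_sum b d j k)"
proof -
  interpret T: group "wreath \<Omega> F" using F by (rule group_wreath)
  have transport: "(\<gamma> [^]\<^bsub>wreath \<Omega> F\<^esub> n) (st j \<zeta>)
      = st (j + int n * b) (\<zeta> + (\<Sum>i<n. d (j + int i * b)))"
    if "j \<in> W" "j + int n * b \<in> W" for j \<zeta> and n :: nat
    by (rule wreath_nat_pow_transport[where W = W and st = st and d = d and b = b, OF F \<gamma> conv st step that])
  show ?thesis
  proof (cases "k \<ge> 0")
    case True
    define n where "n = nat k"
    have k: "k = int n" using True by (simp add: n_def)
    show ?thesis
      using transport[of j n \<zeta>] j by (simp add: k power_sum_def int_pow_int)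
  next
    case False
    define n where "n = nat (- k)"
    define j' where "j' = j + k * b"
    define \<zeta>' where "\<zeta>' = \<zeta> - (\<Sum>i<n. d (j' + int i * b))"
    have k: "k = - int n" using False by (simp add: n_def)
    have j': "j' \<in> W" "j' + int n * b = j" using j by (simp_all add: j'_def k)
    have pow: "\<gamma> [^]\<^bsub>wreath \<Omega> F\<^esub> n \<in> carrier (wreath \<Omega> F)"
      using \<gamma> by simp
    have "(\<gamma> [^]\<^bsub>wreath \<Omega> F\<^esub> n) (st j' \<zeta>') = st j \<zeta>"
      using transport[of j' n \<zeta>'] j j' by (simp add: \<zeta>'_def)
    moreover have "(inv\<^bsub>wreath \<Omega> F\<^esub> (\<gamma> [^]\<^bsub>wreath \<Omega> F\<^esub> n)) ((\<gamma> [^]\<^bsub>wreath \<Omega> F\<^esub> n) (st j' \<zeta>')) = st j' \<zeta>'"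
      using wreath_mult[OF T.inv_closed[OF pow] pow st[OF j'(1)]] pow st[OF j'(1)]
      by (simp add: wreath_one)
    ultimately have "(\<gamma> [^]\<^bsub>wreath \<Omega> F\<^esub> k) (st j \<zeta>) = st j' \<zeta>'"
      using \<gamma> by (simp add: k T.int_pow_neg_int)
    moreover have "\<zeta>' = \<zeta> + power_sum b d j k"
      using False by (simp add: \<zeta>'_def power_sum_def n_def j'_def)
    ultimately show ?thesis by (simp add: j'_def)
  qed
qed

text \<open>
  The positions that a word visits between two syllables differ from its starting point by the
  heights of its suffixes.  The
  lemma is used for two families of states: those away from the seam, where the second component
  collects the weights, and those near it, where only the number of crossings matters.
\<close>

lemma word_value_transport:
  fixes W :: "int set" and a :: "'a \<Rightarrow> int"
  assumes F: "group F" and \<gamma>: "\<And>x. \<gamma> x \<in> carrier (wreath \<Omega> F)"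
    and conv: "\<And>i j k. i \<in> W \<Longrightarrow> k \<in> W \<Longrightarrow> i \<le> j \<Longrightarrow> j \<le> k \<Longrightarrow> j \<in> W"
    and st: "\<And>j \<zeta>. j \<in> W \<Longrightarrow> st j \<zeta> \<in> \<Omega> \<times> carrier F"
    and step: "\<And>x j \<zeta>. x \<in> fst ` set w \<Longrightarrow> j \<in> W \<Longrightarrow> j + a x \<in> W \<Longrightarrow>
                 \<gamma> x (st j \<zeta>) = st (j + a x) (\<zeta> + c (j, x))"
    and stays: "\<And>u v. w = u @ v \<Longrightarrow> j + height a v \<in> W"
  shows "word_value (wreath \<Omega> F) \<gamma> w (st j \<zeta>) = st (j + height a w) (\<zeta> + path_sum a c j w)"
  using step stays
proof (induction w)
  case Nil
  show ?case using st[of j] Nil(2)[of "[]" "[]"] by (simp add: wreath_one)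
next
  case (Cons s w)
  interpret T: group "wreath \<Omega> F" using F by (rule group_wreath)
  obtain x k where s: "s = (x, k)" by (cases s)
  have IH: "word_value (wreath \<Omega> F) \<gamma> w (st j \<zeta>) = st (j + height a w) (\<zeta> + path_sum a c j w)"
  proof (rule Cons.IH)
    show "j + height a v \<in> W" if "w = u @ v" for u v
      using Cons.prems(2)[of "s # u" v] that by simp
  qed (use Cons.prems(1) in auto)
  have j: "j \<in> W" "j + height a w \<in> W" "j + height a w + k * a x \<in> W"
    using Cons.prems(2)[of "s # w" "[]"] Cons.prems(2)[of "[s]" w] Cons.prems(2)[of "[]" "s # w"]
    by (simp_all add: s algebra_simps)
  have w: "word_value (wreath \<Omega> F) \<gamma> w \<in> carrier (wreath \<Omega> F)"
    by (rule T.word_value_closed[of _ UNIV]) (use \<gamma> in auto)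
  have "word_value (wreath \<Omega> F) \<gamma> (s # w) (st j \<zeta>)
      = (\<gamma> x [^]\<^bsub>wreath \<Omega> F\<^esub> k) (st (j + height a w) (\<zeta> + path_sum a c j w))"
    using wreath_mult[OF T.int_pow_closed[OF \<gamma>] w st[OF j(1)]] by (simp add: s IH)
  also have "\<dots> = st (j + height a w + k * a x)
      (\<zeta> + path_sum a c j w + power_sum (a x) (\<lambda>i. c (i, x)) (j + height a w) k)"
    by (rule wreath_int_pow_transport[where W = W, OF F \<gamma> conv st _ j(2,3)])
       (use Cons.prems(1) s in auto)
  finally show ?case by (simp add: s algebra_simps)
qed

section \<open>The action on a circle with a seam\<close>

text \<open>
  \<open>F\<close> is any group with two marked elements \<open>t\<^sub>0\<close> and \<open>t\<^sub>1\<close>.  The numbers \<open>a x\<close> are the step lengths,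
  \<open>s\<close> is the length of the circle, and \<open>c\<close> assigns a weight to the step with the letter \<open>x\<close> from
  the position \<open>j\<close>.
\<close>

locale winding_cover = F: group F
  for F :: "('f, 'd) monoid_scheme" (structure) +
  fixes t\<^sub>0 t\<^sub>1 :: 'f
    and a :: "'a \<Rightarrow> int" and c :: "int \<times> 'a \<Rightarrow> int" and s p :: int
  assumes t_closed: "t\<^sub>0 \<in> carrier F" "t\<^sub>1 \<in> carrier F"
    and s_pos: "s > 0" and p_pos: "p > 0"
begin

definition \<Omega> :: "(int \<times> int) set" where
  "\<Omega> = {0..<s} \<times> {0..<p}"

text \<open>
  The contribution of \<open>q\<close> crossings of the seam when the accumulated weight is \<open>z\<close>.
\<close>

definition turn :: "int \<Rightarrow> int \<Rightarrow> 'f" where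
  "turn z q = (if z = 0 then t\<^sub>0 else t\<^sub>1) [^]\<^bsub>F\<^esub> q"

text \<open>
  The action of one generator on a position \<open>j\<close>, an accumulated weight \<open>z\<close> and an element of \<open>F\<close>.
  Since \<open>j\<close> lies in \<open>{0..<s}\<close>, the quotient \<open>(j + a x) div s\<close> is the signed number of times
  the step crosses the seam.
\<close>

definition crank :: "'a \<Rightarrow> (int \<times> int) \<times> 'f \<Rightarrow> (int \<times> int) \<times> 'f" where
  "crank x = restrict (\<lambda>((j, z), g).
     (((j + a x) mod s, (z + c (j, x)) mod p), turn z ((j + a x) div s) \<otimes>\<^bsub>F\<^esub> g))
     (\<Omega> \<times> carrier F)"

sublocale W: group "wreath \<Omega> F"
  by (rule group_wreath) (rule F.is_group)

lemma gen_closed: "(if P then t\<^sub>0 else t\<^sub>1) \<in> carrier F"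
  using t_closed by simp

lemma turn_closed [simp]: "turn z q \<in> carrier F"
  unfolding turn_def by (rule F.int_pow_closed[OF gen_closed])

lemma turn_add: "turn z (q + r) = turn z q \<otimes>\<^bsub>F\<^esub> turn z r"
  unfolding turn_def by (rule F.int_pow_mult[OF gen_closed])

lemma turn_0: "turn z 0 = \<one>\<^bsub>F\<^esub>"
  unfolding turn_def by (rule int_pow_0)

lemma turn_1: "turn z 1 = (if z = 0 then t\<^sub>0 else t\<^sub>1)"
  unfolding turn_def by (rule F.int_pow_1[OF gen_closed])

text \<open>
  A step can be undone: the position after it determines the position before it, hence the weight to be
  subtracted from \<open>z\<close>, and then the crossings to be cancelled from the element of \<open>F\<close>.
\<close>

lemma crank_wreath: "crank x \<in> carrier (wreath \<Omega> F)"
proof -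
  let ?S = "\<Omega> \<times> carrier F"
  define rewind where "rewind = (\<lambda>((j, z), g). 
    let i = (j - a x) mod s; y = (z - c (i, x)) mod p
    in ((i, y), inv\<^bsub>F\<^esub> (turn y ((i + a x) div s)) \<otimes>\<^bsub>F\<^esub> g))"
  have "bij_betw (crank x) ?S ?S"
  proof (rule bij_betw_byWitness[where f' = rewind])
    show "\<forall>y\<in>?S. rewind (crank x y) = y"
    proof
      fix y assume y: "y \<in> ?S"
      obtain j z g where y': "y = ((j, z), g)" by (metis surj_pair)
      with y have jz: "j mod s = j" "z mod p = z" and g: "g \<in> carrier F" by (auto simp: \<Omega>_def)
      have i: "((j + a x) mod s - a x) mod s = j"
        using jz(1) by (simp add: mod_diff_left_eq)
      have z: "((z + c (j, x)) mod p - c (j, x)) mod p = z"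
        using jz(2) by (simp add: mod_diff_left_eq)
      show "rewind (crank x y) = y"
        using y g by (simp add: y' rewind_def crank_def Let_def i z F.m_assoc[symmetric])
    qed
    show "\<forall>y\<in>?S. crank x (rewind y) = y"
    proof
      fix y assume y: "y \<in> ?S"
      obtain j z g where y': "y = ((j, z), g)" by (metis surj_pair)
      with y have jz: "j mod s = j" "z mod p = z" and g: "g \<in> carrier F" by (auto simp: \<Omega>_def)
      define i where "i = (j - a x) mod s"
      define u where "u = (z - c (i, x)) mod p"
      have i: "(i + a x) mod s = j"
        using jz(1) by (simp add: i_def mod_add_left_eq)
      have z: "(u + c (i, x)) mod p = z"
        using jz(2) by (simp add: u_def mod_add_left_eq)
      have "(i, u) \<in> \<Omega>" using s_pos p_pos by (simp add: \<Omega>_def i_def u_def)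
      then show "crank x (rewind y) = y"
        using g i z
        by (simp add: y' rewind_def crank_def Let_def i_def[symmetric] u_def[symmetric]
            F.m_assoc[symmetric])
    qed
    show "crank x ` ?S \<subseteq> ?S" "rewind ` ?S \<subseteq> ?S"
      using s_pos p_pos by (auto simp: crank_def rewind_def \<Omega>_def Let_def)
  qed
  then have "crank x \<in> Bij ?S" by (simp add: Bij_def crank_def)
  moreover have "crank x (\<omega>, g \<otimes>\<^bsub>F\<^esub> h) = (fst (crank x (\<omega>, g)), snd (crank x (\<omega>, g)) \<otimes>\<^bsub>F\<^esub> h)"
    if "\<omega> \<in> \<Omega>" "g \<in> carrier F" "h \<in> carrier F" for \<omega> g h
    using that by (cases \<omega>) (simp add: crank_def F.m_assoc)
  ultimately show ?thesis unfolding wreath_carrier by blast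
qed

lemma crank_inside:
  assumes "j \<in> {0..<s}" "j + a x \<in> {0..<s}" "g \<in> carrier F"
  shows "crank x ((j, \<zeta> mod p), g) = ((j + a x, (\<zeta> + c (j, x)) mod p), g)"
proof -
  have "((j, \<zeta> mod p), g) \<in> \<Omega> \<times> carrier F" using assms p_pos by (simp add: \<Omega>_def)
  then have "crank x ((j, \<zeta> mod p), g) = (((j + a x) mod s, (\<zeta> mod p + c (j, x)) mod p),
      turn (\<zeta> mod p) ((j + a x) div s) \<otimes>\<^bsub>F\<^esub> g)"
    by (simp only: crank_def restrict_apply if_True prod.case)
  moreover have "(j + a x) mod s = j + a x" "(j + a x) div s = 0" using assms(2) by auto
  ultimately show ?thesis using F.l_one[OF assms(3)] by (simp only: turn_0 mod_add_left_eq)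
qed

text \<open>
  Here \<open>j\<close> is an arbitrary integer: on the infinite cyclic cover of the circle, with vertex set \<open>\<int>\<close>, the
  number of crossings up to \<open>j\<close> is \<open>j div s\<close>, so along weightless steps the element of \<open>F\<close> depends on
  the position in the cover only.
\<close>

lemma crank_seam:
  assumes "c (j mod s, x) = 0" "z \<in> {0..<p}" "g \<in> carrier F"
  shows "crank x ((j mod s, z), turn z (j div s) \<otimes>\<^bsub>F\<^esub> g)
       = (((j + a x) mod s, z), turn z ((j + a x) div s) \<otimes>\<^bsub>F\<^esub> g)"
proof -
  have "((j mod s, z), turn z (j div s) \<otimes>\<^bsub>F\<^esub> g) \<in> \<Omega> \<times> carrier F"
    using assms s_pos by (simp add: \<Omega>_def)
  then have "crank x ((j mod s, z), turn z (j div s) \<otimes>\<^bsub>F\<^esub> g)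
     = (((j mod s + a x) mod s, z mod p),
        turn z ((j mod s + a x) div s) \<otimes>\<^bsub>F\<^esub> (turn z (j div s) \<otimes>\<^bsub>F\<^esub> g))"
    by (simp only: crank_def restrict_apply if_True prod.case assms(1) add_0_right)
  also have "turn z ((j mod s + a x) div s) \<otimes>\<^bsub>F\<^esub> (turn z (j div s) \<otimes>\<^bsub>F\<^esub> g)
     = turn z ((j mod s + a x) div s + j div s) \<otimes>\<^bsub>F\<^esub> g"
    using assms(3) by (simp only: turn_add F.m_assoc turn_closed)
  also have "(j mod s + a x) div s + j div s = (j mod s + a x + j div s * s) div s"
    using s_pos div_mult_self1[of s "j mod s + a x" "j div s"] by simp
  also have "j mod s + a x + j div s * s = j + a x"
    using mult_div_mod_eq[of s j] by (simp add: algebra_simps)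
  finally show ?thesis using assms(2) by (simp add: mod_add_left_eq)
qed

abbreviation act :: "'a word \<Rightarrow> (int \<times> int) \<times> 'f \<Rightarrow> (int \<times> int) \<times> 'f" where
  "act \<equiv> word_value (wreath \<Omega> F) crank"

lemma act_hom: "act \<in> hom (free_group X) (wreath \<Omega> F)"
  using crank_wreath by (intro W.word_value_hom) auto

lemma act_closed: "act w \<in> carrier (wreath \<Omega> F)"
  by (rule W.word_value_closed[of _ UNIV]) (use crank_wreath in auto)

lemma act_inside:
  assumes "\<And>u v. w = u @ v \<Longrightarrow> j + height a v \<in> {0..<s}" "g \<in> carrier F"
  shows "act w ((j, \<zeta> mod p), g) = ((j + height a w, (\<zeta> + path_sum a c j w) mod p), g)"
proof (rule word_value_transport[where W = "{0..<s}" and st = "\<lambda>j \<zeta>. ((j, \<zeta> mod p), g)"])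
  show "((i, \<zeta> mod p), g) \<in> \<Omega> \<times> carrier F" if "i \<in> {0..<s}" for i \<zeta>
    using that assms(2) p_pos by (simp add: \<Omega>_def)
  show "crank x ((i, \<zeta> mod p), g) = ((i + a x, (\<zeta> + c (i, x)) mod p), g)"
    if "i \<in> {0..<s}" "i + a x \<in> {0..<s}" for x i \<zeta>
    using that assms(2) by (rule crank_inside)
  show "j + height a v \<in> {0..<s}" if "w = u @ v" for u v
    using that by (rule assms(1))
qed (simp_all add: crank_wreath F.is_group)

lemma act_seam:
  fixes W :: "int set"
  assumes conv: "\<And>i j k. i \<in> W \<Longrightarrow> k \<in> W \<Longrightarrow> i \<le> j \<Longrightarrow> j \<le> k \<Longrightarrow> j \<in> W"
    and c: "\<And>i x. i \<in> W \<Longrightarrow> x \<in> fst ` set w \<Longrightarrow> c (i mod s, x) = 0"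
    and W: "\<And>u v. w = u @ v \<Longrightarrow> j + height a v \<in> W"
    and zg: "z \<in> {0..<p}" "g \<in> carrier F"
  shows "act w ((j mod s, z), turn z (j div s) \<otimes>\<^bsub>F\<^esub> g)
     = (((j + height a w) mod s, z), turn z ((j + height a w) div s) \<otimes>\<^bsub>F\<^esub> g)"
proof (rule word_value_transport[where W = W and \<zeta> = 0 and c = "\<lambda>_. 0" and
      st = "\<lambda>j \<zeta>. ((j mod s, z), turn z (j div s) \<otimes>\<^bsub>F\<^esub> g)"])
  show "((i mod s, z), turn z (i div s) \<otimes>\<^bsub>F\<^esub> g) \<in> \<Omega> \<times> carrier F" for i
    using zg s_pos by (simp add: \<Omega>_def)
  show "crank x ((i mod s, z), turn z (i div s) \<otimes>\<^bsub>F\<^esub> g)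
     = (((i + a x) mod s, z), turn z ((i + a x) div s) \<otimes>\<^bsub>F\<^esub> g)"
    if "x \<in> fst ` set w" "i \<in> W" for x i
    using c[OF that(2,1)] zg by (rule crank_seam)
  show "k \<in> W" if "i \<in> W" "l \<in> W" "i \<le> k" "k \<le> l" for i k l
    using that by (rule conv)
  show "j + height a v \<in> W" if "w = u @ v" for u v
    using that by (rule W)
qed (simp_all add: crank_wreath F.is_group)

text \<open>
  The dichotomy on which the proof rests.  From a position at distance at least \<open>K\<close> from the seam the word never
  crosses it, and its \<open>m\<close>-th power shifts the weight by a multiple of \<open>p\<close>.  From any other
  position it stays at distance at most \<open>2 * K\<close> from the seam, where all weights vanish, and it
  returns to the same vertex of the infinite cyclic cover, so all crossings cancel.
\<close>

lemma act_relator: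
  fixes m :: nat
  assumes K: "2 * K \<le> s"
    and suffix: "\<And>u v. w = u @ v \<Longrightarrow> \<bar>height a v\<bar> \<le> K" and level: "height a w = 0"
    and c: "\<And>i x. x \<in> fst ` set w \<Longrightarrow> 0 \<le> i \<Longrightarrow> i < s \<Longrightarrow> i < 2 * K \<or> s - 2 * K \<le> i \<Longrightarrow> c (i, x) = 0"
    and p: "\<And>j. K \<le> j \<Longrightarrow> j < s - K \<Longrightarrow> p dvd int m * path_sum a c j w"
  shows "act w [^]\<^bsub>wreath \<Omega> F\<^esub> m = \<one>\<^bsub>wreath \<Omega> F\<^esub>"
proof -
  have K0: "K \<ge> 0" using suffix[of w "[]"] by simp
  have shift: "\<exists>e. p dvd int m * e \<and> (\<forall>\<zeta>. act w ((j, \<zeta> mod p), g) = ((j, (\<zeta> + e) mod p), g))"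
    if j: "j \<in> {0..<s}" and g: "g \<in> carrier F" for j g
  proof (cases "K \<le> j \<and> j < s - K")
    case True
    have "j + height a v \<in> {0..<s}" if "w = u @ v" for u v
      using suffix[OF that] True by (simp add: abs_le_iff)
    from act_inside[of w, OF this g] p[of j] True level show ?thesis by auto
  next
    case False
    have "act w ((j, \<zeta> mod p), g) = ((j, (\<zeta> + 0) mod p), g)" for \<zeta>
    proof -
      have "act w ((j mod s, \<zeta> mod p), turn (\<zeta> mod p) (j div s) \<otimes>\<^bsub>F\<^esub> g)
        = (((j + height a w) mod s, \<zeta> mod p), turn (\<zeta> mod p) ((j + height a w) div s) \<otimes>\<^bsub>F\<^esub> g)"
      proof (rule act_seam[where W = "{j - K..j + K}"])
        fix i x assume i: "i \<in> {j - K..j + K}" and x: "x \<in> fst ` set w"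
        have "0 \<le> i mod s \<and> i mod s < s \<and> (i mod s < 2 * K \<or> s - 2 * K \<le> i mod s)"
        proof (cases "i < 0 \<or> i \<ge> s")
          case False
          then show ?thesis using i j \<open>\<not> (K \<le> j \<and> j < s - K)\<close> by auto
        next
          case True
          then show ?thesis
          proof
            assume "i < 0"
            then have "(i + s) mod s = i + s" using i j K by (intro mod_pos_pos_trivial) auto
            then show ?thesis using i j K K0 \<open>i < 0\<close> by simp
          next
            assume "i \<ge> s"
            then have "(i - s) mod s = i - s" using i j K by (intro mod_pos_pos_trivial) auto
            then have "i mod s = i - s" by simp
            then show ?thesis using i j K K0 \<open>i \<ge> s\<close> by simp
          qed
        qed
        then show "c (i mod s, x) = 0" using c[OF x] by blast
      next
        show "j + height a v \<in> {j - K..j + K}" if "w = u @ v" for u v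
          using suffix[OF that] by auto
      qed (use g p_pos in auto)
      then show ?thesis using j g level F.l_one[OF g] by (simp add: turn_0)
    qed
    then show ?thesis by (intro exI[of _ 0]) simp
  qed
  have "(act w [^]\<^bsub>wreath \<Omega> F\<^esub> m) y = y" if y: "y \<in> \<Omega> \<times> carrier F" for y
  proof -
    obtain j z g where y': "y = ((j, z), g)" by (metis surj_pair)
    with y have j: "j \<in> {0..<s}" and z: "z mod p = z" and g: "g \<in> carrier F" by (auto simp: \<Omega>_def)
    obtain e where e: "p dvd int m * e" "\<And>\<zeta>. act w ((j, \<zeta> mod p), g) = ((j, (\<zeta> + e) mod p), g)"
      using shift[OF j g] by blast
    have "(act w [^]\<^bsub>wreath \<Omega> F\<^esub> l) y = ((j, (z + int l * e) mod p), g)" for l :: nat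
    proof (induction l)
      case 0
      show ?case using y z by (simp add: y' wreath_one)
    next
      case (Suc l)
      have "(act w [^]\<^bsub>wreath \<Omega> F\<^esub> Suc l) y = act w ((act w [^]\<^bsub>wreath \<Omega> F\<^esub> l) y)"
        using W.nat_pow_Suc2[OF act_closed] wreath_mult[OF act_closed W.nat_pow_closed[OF act_closed] y]
        by simp
      then show ?case by (simp add: Suc e(2) algebra_simps)
    qed
    moreover have "(z + int m * e) mod p = z"
      using e(1) z by (metis add.right_neutral dvd_imp_mod_0 mod_add_right_eq)
    ultimately show ?thesis by (simp add: y')
  qed
  moreover have "act w [^]\<^bsub>wreath \<Omega> F\<^esub> m \<in> extensional (\<Omega> \<times> carrier F)"
    using W.nat_pow_closed[OF act_closed, of w m] unfolding wreath_carrier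
    by (blast intro: Bij_imp_extensional)
  ultimately show ?thesis
    unfolding wreath_one by (intro extensionalityI[where A = "\<Omega> \<times> carrier F"]) auto
qed

text \<open>
  The base point \<open>j0\<close> lies near the seam in the residue class of \<open>j\<close> modulo \<open>a x0\<close>.  The loop \<open>v\<close>, a
  power of \<open>x0\<close>, winds around the circle once and has no weight.  The loop \<open>u\<close>, the commutator of \<open>x\<close>
  with a power of \<open>x0\<close>, does not cross the seam; it runs through the edge \<open>(j, x)\<close> forwards and through
  the edge \<open>(j0, x)\<close>, whose weight is zero, backwards, so its total weight is \<open>c (j, x)\<close>.
\<close>

lemma act_generators:
  assumes x0: "x0 \<in> X" "a x0 \<noteq> 0" "a x0 dvd s" "\<And>i. c (i, x0) = 0"
    and M: "\<And>x. x \<in> X \<Longrightarrow> \<bar>a x\<bar> \<le> M" "2 * M \<le> B"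
    and c: "\<And>i x. i < B \<Longrightarrow> c (i, x) = 0"
    and x: "x \<in> X" "j < s - B" "\<not> p dvd c (j, x)"
  shows "\<exists>\<omega>\<in>\<Omega>. \<forall>y\<in>{t\<^sub>0, t\<^sub>1}. \<exists>u\<in>carrier (free_group X). act u (\<omega>, \<one>\<^bsub>F\<^esub>) = (\<omega>, y)"
proof -
  define D where "D = \<bar>a x0\<bar>"
  \<comment> \<open>The offset \<open>M\<close> keeps \<open>j0 + a x\<close> non-negative; \<open>2 * M \<le> B\<close> and \<open>D \<le> M\<close> keep \<open>j0\<close> below \<open>B\<close>.\<close>
  define j0 where "j0 = M + (j - M) mod D"
  have D: "0 < D" "D \<le> M" using x0 M by (simp_all add: D_def)
  have jB: "B \<le> j" using c[of j x] x(3) by force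
  have "0 \<le> (j - M) mod D" "(j - M) mod D < D" using D by simp_all
  then have j0: "M \<le> j0" "j0 < B" using D M(2) unfolding j0_def by linarith+
  have "j - j0 = D * ((j - M) div D)" by (simp add: j0_def minus_mod_eq_mult_div [symmetric])
  then have "a x0 dvd j - j0" by (simp add: D_def)
  then obtain m where m: "j = j0 + m * a x0" by (metis add.commute diff_add_cancel dvdE mult.commute)
  have m0: "m \<noteq> 0" using m jB j0 by auto
  have xx0: "x \<noteq> x0" using x(3) x0(4) by auto
  have j0s: "0 \<le> j0" "j0 < s" using j0 jB x(2) D M by auto
  obtain r where r: "s = r * a x0" using x0(3) by (metis dvdE mult.commute)
  have r0: "r \<noteq> 0" using r s_pos by auto
  define v where "v = [(x0, r)]"
  define u where "u = [(x, - 1), (x0, - m), (x, 1), (x0, m)]"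
  have v_in: "v \<in> carrier (free_group X)" and u_in: "u \<in> carrier (free_group X)"
    using x0(1) x(1) r0 m0 xx0 by (auto simp: u_def v_def carrier_free_group reduced_Cons)
  interpret act: group_hom "free_group X" "wreath \<Omega> F" act
    by (simp add: group_hom_def group_hom_axioms_def act_hom group_free_group W.is_group)
  have act_v: "act v ((j0, z), \<one>\<^bsub>F\<^esub>) = ((j0, z), (if z = 0 then t\<^sub>0 else t\<^sub>1))"
    if z: "z \<in> {0..<p}" for z
  proof -
    have "act v ((j0 mod s, z), turn z (j0 div s) \<otimes>\<^bsub>F\<^esub> \<one>\<^bsub>F\<^esub>)
        = (((j0 + height a v) mod s, z), turn z ((j0 + height a v) div s) \<otimes>\<^bsub>F\<^esub> \<one>\<^bsub>F\<^esub>)"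
      by (rule act_seam[where W = UNIV]) (use z x0(4) F.one_closed in \<open>auto simp: v_def\<close>)
    moreover have "(j0 + height a v) mod s = j0" "(j0 + height a v) div s = 1"
      using j0s s_pos by (simp_all add: v_def r[symmetric] div_add_self2)
    ultimately show ?thesis
      using j0s gen_closed by (simp add: turn_0 turn_1 F.r_one F.l_one)
  qed
  have act_u: "act u ((j0, \<zeta> mod p), g) = ((j0, (\<zeta> + c (j, x)) mod p), g)" if g: "g \<in> carrier F" for \<zeta> g
  proof -
    have bounds: "0 \<le> j0 + a x" "j0 + a x < s" "0 \<le> j + a x" "j + a x < s" "0 \<le> j" "j < s"
      using M(1)[OF x(1)] j0 j0s jB x(2) M(2) by linarith+
    have "act u ((j0, \<zeta> mod p), g)
        = ((j0 + height a u, (\<zeta> + path_sum a c j0 u) mod p), g)"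
    proof (rule act_inside[OF _ g])
      fix u' v' assume "u = u' @ v'"
      then consider "v' = []" | "v' = [(x0, m)]" | "v' = [(x, 1), (x0, m)]"
        | "v' = [(x0, - m), (x, 1), (x0, m)]" | "v' = u"
        by (auto simp: u_def Cons_eq_append_conv)
      then show "j0 + height a v' \<in> {0..<s}"
        using bounds j0s by cases (simp_all add: u_def m algebra_simps)
    qed
    moreover have "height a u = 0" by (simp add: u_def)
    moreover have "path_sum a c j0 u = c (j, x)"
      using c[OF j0(2)] by (simp add: u_def x0(4) power_sum_def m)
    ultimately show ?thesis by simp
  qed
  define e where "e = c (j, x) mod p"
  have e: "e \<noteq> 0" "e \<in> {0..<p}" using x(3) p_pos by (auto simp: e_def dvd_eq_mod_eq_0)
  let ?\<omega> = "(j0, 0 :: int)"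
  have \<omega>: "?\<omega> \<in> \<Omega>" using j0s p_pos by (simp add: \<Omega>_def)
  \<comment> \<open>The loop \<open>u\<close> changes the weight from \<open>0\<close> to \<open>e\<close>, at which a turn contributes \<open>t\<^sub>1\<close>.\<close>
  let ?t = "inv\<^bsub>free_group X\<^esub> u \<otimes>\<^bsub>free_group X\<^esub> (v \<otimes>\<^bsub>free_group X\<^esub> u)"
  have t_in: "?t \<in> carrier (free_group X)" using u_in v_in by simp
  note g2 = t_closed(2)
  have act_mult: "act (x \<otimes>\<^bsub>free_group X\<^esub> y) q = act x (act y q)"
    if "x \<in> carrier (free_group X)" "y \<in> carrier (free_group X)" "q \<in> \<Omega> \<times> carrier F" for x y q
    using that(3) by (simp only: act.hom_mult[OF that(1,2)] wreath_mult[OF act_closed act_closed])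
  have states: "(?\<omega>, t\<^sub>1) \<in> \<Omega> \<times> carrier F" "(?\<omega>, \<one>\<^bsub>F\<^esub>) \<in> \<Omega> \<times> carrier F"
    using \<omega> g2 by simp_all
  have u_moves: "act u (?\<omega>, g) = ((j0, e), g)" if "g \<in> carrier F" for g
    using act_u[OF that, of 0] by (simp add: e_def)
  let ?u' = "inv\<^bsub>free_group X\<^esub> u"
  have u'_in: "?u' \<in> carrier (free_group X)" using u_in by simp
  have "act ?u' (act u (?\<omega>, t\<^sub>1)) = act (?u' \<otimes>\<^bsub>free_group X\<^esub> u) (?\<omega>, t\<^sub>1)"
    by (rule act_mult[OF u'_in u_in states(1), symmetric])
  also have "?u' \<otimes>\<^bsub>free_group X\<^esub> u = []" using u_in by simp
  finally have u'_moves: "act ?u' ((j0, e), t\<^sub>1) = (?\<omega>, t\<^sub>1)"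
    unfolding u_moves[OF g2] using states(1) by (simp add: wreath_one)
  have vu_in: "v \<otimes>\<^bsub>free_group X\<^esub> u \<in> carrier (free_group X)" using v_in u_in by simp
  have "act ?t (?\<omega>, \<one>\<^bsub>F\<^esub>) = act ?u' (act v (act u (?\<omega>, \<one>\<^bsub>F\<^esub>)))"
    unfolding act_mult[OF u'_in vu_in states(2)] act_mult[OF v_in u_in states(2)] ..
  also have "\<dots> = act ?u' ((j0, e), t\<^sub>1)"
    unfolding u_moves[OF F.one_closed] act_v[OF e(2)] using e(1) by simp
  finally have "act ?t (?\<omega>, \<one>\<^bsub>F\<^esub>) = (?\<omega>, t\<^sub>1)" unfolding u'_moves .
  moreover have "act v (?\<omega>, \<one>\<^bsub>F\<^esub>) = (?\<omega>, t\<^sub>0)" using act_v[of 0] p_pos by simp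
  ultimately show ?thesis using \<omega> v_in t_in by blast
qed

end

section \<open>Solving the linear conditions\<close>

text \<open>
  Fewer homogeneous linear conditions than unknowns.  There are more assignments of residues
  to the unknowns than values of the conditions modulo \<open>p\<close>, so two assignments agree on all
  conditions, and their difference is a solution.
\<close>

lemma nonzero_solution_mod:
  fixes p :: int and L :: "('e \<Rightarrow> int) \<Rightarrow> 'j \<Rightarrow> int"
  assumes p: "p > 1" and fin: "finite E" "finite J" and card: "card J < card E"
    and L: "\<And>f g j. L (\<lambda>e. f e - g e) j = L f j - L g j"
  shows "\<exists>c. (\<forall>e. e \<notin> E \<longrightarrow> c e = 0) \<and> (\<exists>e\<in>E. \<not> p dvd c e) \<and> (\<forall>j\<in>J. p dvd L c j)"
proof -
  define A where "A = E \<rightarrow>\<^sub>E {0..<p}"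
  define ext :: "('e \<Rightarrow> int) \<Rightarrow> 'e \<Rightarrow> int" where "ext f = (\<lambda>e. if e \<in> E then f e else 0)" for f
  define \<phi> where "\<phi> f = (\<lambda>j\<in>J. L (ext f) j mod p)" for f
  have "\<phi> ` A \<subseteq> J \<rightarrow>\<^sub>E {0..<p}" using p by (auto simp: \<phi>_def)
  then have "card (\<phi> ` A) \<le> card (J \<rightarrow>\<^sub>E {0..<p})"
    by (intro card_mono finite_PiE fin) auto
  also have "\<dots> = nat p ^ card J" using fin by (simp add: card_PiE)
  also have "\<dots> < nat p ^ card E" using p card by (intro power_strict_increasing) auto
  also have "\<dots> = card A" using fin by (simp add: A_def card_PiE)
  finally have "\<not> inj_on \<phi> A" by (rule pigeonhole)
  then obtain f g where fg: "f \<in> A" "g \<in> A" "\<phi> f = \<phi> g" "f \<noteq> g" by (auto simp: inj_on_def)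
  then obtain e where e: "e \<in> E" "f e \<noteq> g e" unfolding A_def by (metis PiE_ext)
  define c where "c = (\<lambda>e. ext f e - ext g e)"
  have "\<not> p dvd c e"
  proof
    assume "p dvd c e"
    then have "p dvd f e - g e" using e by (simp add: c_def ext_def)
    then have "f e mod p = g e mod p" by (simp add: mod_eq_dvd_iff)
    moreover have "f e \<in> {0..<p}" "g e \<in> {0..<p}" using fg e by (auto simp: A_def)
    ultimately show False using e(2) by simp
  qed
  moreover have "p dvd L c j" if "j \<in> J" for j
  proof -
    have "L (ext f) j mod p = L (ext g) j mod p"
      using fun_cong[OF fg(3), of j] that by (simp add: \<phi>_def)
    then show ?thesis by (simp add: c_def L mod_eq_dvd_iff)
  qed
  moreover have "c e' = 0" if "e' \<notin> E" for e' using that by (simp add: c_def ext_def)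
  ultimately show ?thesis using e(1) by blast
qed

section \<open>Largeness\<close>

lemma hom_integer_eq_height:
  assumes "f \<in> hom (free_group X) integer_group" "w \<in> carrier (free_group X)"
  shows "f w = height (\<lambda>x. f (free_gen x)) w"
proof -
  have "word_value integer_group a w = height a w" for a :: "'a \<Rightarrow> int"
    by (induction w) auto
  then show ?thesis using hom_eq_word_value[OF group_integer_group assms] by simp
qed

lemma prefix_height_le_Delta:
  assumes "w = u @ v"
  shows "\<bar>height (\<lambda>x. f (free_gen x)) u\<bar> \<le> Delta f w"
proof (cases "u = []")
  case True
  have "0 \<le> Delta f w"
  proof (cases "w = []")
    case False
    then have "1 \<in> {1..length w}" by (cases w) auto
    then have "\<bar>Delta_partial f 1 w\<bar> \<le> Max ((\<lambda>j. \<bar>Delta_partial f j w\<bar>) ` {1..length w})"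
      by (intro Max_ge) auto
    then show ?thesis using False by (simp add: Delta_def)
  qed (simp add: Delta_def)
  then show ?thesis using True by simp
next
  case False
  then have "length u \<in> {1..length w}" using assms by (cases u) auto
  then have "\<bar>Delta_partial f (length u) w\<bar> \<le> Max ((\<lambda>j. \<bar>Delta_partial f j w\<bar>) ` {1..length w})"
    by (intro Max_ge) auto
  then show ?thesis using False assms by (simp add: Delta_def Delta_partial_def height_def)
qed

theorem theorem3p5:
  fixes n K p :: nat
    and w :: "nat \<Rightarrow> nat word"
    and \<alpha> :: "nat \<Rightarrow> nat"
    and R :: "nat word set"
    and G :: "nat word set monoid"
    and \<psi> :: "nat word set \<Rightarrow> int"
  assumes "n > 1"
    and "\<And>i. w i \<in> carrier (free_group {1..n})"
    and "\<And>i. \<alpha> i > 0"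
    and "R = range (\<lambda>i. w i [^]\<^bsub>free_group {1..n}\<^esub> \<alpha> i)"
    and "G = presented_group {1..n} R"
    and "\<psi> \<in> epi G integer_group"
    and "\<And>i. Delta (\<psi> \<circ> presentation_map {1..n} R) (w i) \<le> int K"
    and "prime p"
    and "finite {i. \<not> p dvd \<alpha> i}"
    and "card {i. \<not> p dvd \<alpha> i} \<le> n - 2"
  shows "large G"
proof -
  let ?X = "{1..n}" and ?F = "free_group {1..n}" and ?F2 = "free_group {1, 2 :: nat}"
  let ?I = "{i. \<not> p dvd \<alpha> i}"
  interpret F: group ?F by (rule group_free_group)
  have R: "R \<subseteq> carrier ?F"
    using assms(2) F.nat_pow_closed by (auto simp: assms(4))
  have G: "group G" unfolding assms(5) using R by (rule group_presented_group)
  define f where "f = \<psi> \<circ> presentation_map ?X R"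
  define a where "a x = f (free_gen x)" for x
  have f: "f \<in> hom ?F integer_group"
    unfolding f_def using presentation_map_hom[OF R] assms(5,6) by (auto simp: epi_def intro: hom_compose)
  have f_height: "f u = height a u" if "u \<in> carrier ?F" for u
    using hom_integer_eq_height[OF f that] by (simp add: a_def[abs_def])
  have level: "height a (w i) = 0" for i
  proof -
    have "w i [^]\<^bsub>?F\<^esub> \<alpha> i \<in> R" by (auto simp: assms(4))
    from presentation_map_relator[OF R this]
    have "f (w i [^]\<^bsub>?F\<^esub> \<alpha> i) = \<psi> \<one>\<^bsub>G\<^esub>" by (simp add: f_def assms(5))
    also have "\<dots> = 0"
      using hom_one[OF _ G group_integer_group] assms(6) by (auto simp: epi_def)
    finally have "int (\<alpha> i) * f (w i) = 0"
      using hom_nat_pow[OF f assms(2) F.is_group group_integer_group] by simp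
    then show ?thesis using assms(3)[of i] f_height[OF assms(2)] by simp
  qed
  \<comment> \<open>\<open>\<Delta>\<close> bounds prefixes; since \<open>w i\<close> has height \<open>0\<close>, a suffix has minus the height of its prefix.\<close>
  have suffix: "\<bar>height a v\<bar> \<le> int K" if "w i = u @ v" for i u v
  proof -
    have "\<bar>height a u\<bar> \<le> int K"
      using prefix_height_le_Delta[OF that, of f] assms(7)[of i] by (simp add: a_def[abs_def] f_def)
    moreover have "height a u + height a v = 0" using level[of i] that by simp
    ultimately show ?thesis by linarith
  qed
  obtain x0 where x0: "x0 \<in> ?X" "a x0 \<noteq> 0"
  proof -
    have "\<exists>x\<in>?X. a x \<noteq> 0"
    proof (rule ccontr)
      assume "\<not> (\<exists>x\<in>?X. a x \<noteq> 0)"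
      then have zero: "height a u = 0" if "fst ` set u \<subseteq> ?X" for u
        using that by (induction u) auto
      have "1 \<in> \<psi> ` carrier G" using assms(6) by (simp add: epi_def)
      then obtain u where "u \<in> carrier ?F" "f u = 1"
        by (auto simp: assms(5) carrier_presented_group f_def)
      then show False using zero f_height by (simp add: carrier_free_group)
    qed
    then show ?thesis using that by blast
  qed
  define M where "M = Max ((\<lambda>x. \<bar>a x\<bar>) ` ?X)"
  have M: "\<bar>a x\<bar> \<le> M" if "x \<in> ?X" for x
    unfolding M_def using that by (intro Max_ge) auto
  have M0: "M \<ge> 1" using M[OF x0(1)] x0(2) by linarith
  \<comment> \<open>Weights are allowed at distance at least \<open>B\<close> from the seam only.  The summand \<open>2 * K\<close> is needed for
     the relators, the summand \<open>2 * M\<close> for the base point; \<open>s\<close> is a multiple of \<open>a x0\<close> so large that the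
     unknowns outnumber the conditions.\<close>
  define B where "B = 2 * int K + 2 * M"
  define s where "s = \<bar>a x0\<bar> * (2 * B * (int n - 1) + 1)"
  have B0: "B \<ge> 0" using M0 by (simp add: B_def)
  have s_large: "2 * B * (int n - 1) < s"
  proof -
    have "1 * (2 * B * (int n - 1) + 1) \<le> s"
      unfolding s_def using x0(2) B0 assms(1) by (intro mult_right_mono) auto
    then show ?thesis by simp
  qed
  have s2B: "2 * B < s"
  proof -
    have "2 * B * 1 \<le> 2 * B * (int n - 1)" using B0 assms(1) by (intro mult_left_mono) auto
    with s_large show ?thesis by simp
  qed
  define E where "E = {B..<s - B} \<times> (?X - {x0})"
  have p1: "int p > 1" using assms(8) prime_gt_1_nat by simp
  have "card (?I \<times> {0..<s}) < card E"
  proof -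
    have "int (card (?I \<times> {0..<s})) = int (card ?I) * s"
      using s2B B0 by (simp add: card_cartesian_product)
    also have "\<dots> \<le> (int n - 2) * s"
      using assms(1,10) s2B B0 by (intro mult_right_mono) auto
    also have "\<dots> < (s - 2 * B) * (int n - 1)" using s_large by (simp add: algebra_simps)
    also have "\<dots> = int (card E)"
      using s2B x0(1) assms(1) by (simp add: E_def card_cartesian_product of_nat_diff)
    finally show ?thesis by simp
  qed
  moreover have "finite (?I \<times> {0..<s})" "finite E"
    using assms(9) by (simp_all add: E_def)
  ultimately have "\<exists>c. (\<forall>e. e \<notin> E \<longrightarrow> c e = 0) \<and> (\<exists>e\<in>E. \<not> int p dvd c e) \<and>
      (\<forall>ij\<in>?I \<times> {0..<s}. int p dvd path_sum a c (snd ij) (w (fst ij)))"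
    using p1 by (intro nonzero_solution_mod) (auto simp: path_sum_diff)
  then obtain c where c: "\<forall>e. e \<notin> E \<longrightarrow> c e = 0" "\<exists>e\<in>E. \<not> int p dvd c e"
      and c_sum: "\<forall>ij\<in>?I \<times> {0..<s}. int p dvd path_sum a c (snd ij) (w (fst ij))"
    by (elim exE conjE)
  have c_out: "c e = 0" if "e \<notin> E" for e using c(1) that by blast
  have c_path: "int p dvd path_sum a c j (w i)" if "\<not> p dvd \<alpha> i" "0 \<le> j" "j < s" for i j
    using bspec[OF c_sum, of "(i, j)"] that by simp
  interpret F2: group ?F2 by (rule group_free_group)
  have t: "free_gen 1 \<in> carrier ?F2" "free_gen 2 \<in> carrier ?F2"
    by (rule free_gen_closed; simp)+
  interpret winding_cover ?F2 "free_gen 1" "free_gen 2" a c s "int p"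
    using t s2B B0 p1 by unfold_locales auto
  interpret act: group_hom ?F "wreath \<Omega> ?F2" act
    using act_hom[of ?X] W.is_group F.is_group by (simp add: group_hom_def group_hom_axioms_def)
  have "R \<subseteq> kernel ?F (wreath \<Omega> ?F2) act"
  proof
    fix r assume "r \<in> R"
    then obtain i where r: "r = w i [^]\<^bsub>?F\<^esub> \<alpha> i" by (auto simp: assms(4))
    have "act (w i) [^]\<^bsub>wreath \<Omega> ?F2\<^esub> \<alpha> i = \<one>\<^bsub>wreath \<Omega> ?F2\<^esub>"
    proof (rule act_relator[where K = "int K"])
      show "2 * int K \<le> s" using s2B B0 M0 by (simp add: B_def)
      show "\<bar>height a v\<bar> \<le> int K" if "w i = u @ v" for u v using suffix[OF that] .
      show "height a (w i) = 0" by (rule level)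
      show "c (j, x) = 0" if "j < 2 * int K \<or> s - 2 * int K \<le> j" for j x
        using that M0 by (intro c_out) (auto simp: E_def B_def)
      show "int p dvd int (\<alpha> i) * path_sum a c j (w i)" if "int K \<le> j" "j < s - int K" for j
      proof (cases "p dvd \<alpha> i")
        case False
        then show ?thesis using c_path[of i j] that by (intro dvd_mult) auto
      qed simp
    qed
    then show "r \<in> kernel ?F (wreath \<Omega> ?F2) act"
      using act.hom_nat_pow[OF assms(2)] R \<open>r \<in> R\<close> by (auto simp: kernel_def r)
  qed
  then have kernel: "normal_closure ?F R \<subseteq> kernel ?F (wreath \<Omega> ?F2) act"
    by (rule act.normal_closure_subset_kernel)
  obtain \<theta> where \<theta>: "\<theta> \<in> hom G (wreath \<Omega> ?F2)"
      "\<And>u. u \<in> carrier ?F \<Longrightarrow> \<theta> (presentation_map ?X R u) = act u"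
    using act.FactGroup_universal_kernel[OF F.normal_closure_normal[OF R] kernel]
    unfolding assms(5) presented_group_def presentation_map_def by blast
  obtain j x where jx: "(j, x) \<in> E" "\<not> int p dvd c (j, x)" using c(2) by auto
  have "\<exists>\<omega>\<in>\<Omega>. \<forall>y\<in>{free_gen 1, free_gen 2}. \<exists>u\<in>carrier ?F. act u (\<omega>, \<one>\<^bsub>?F2\<^esub>) = (\<omega>, y)"
  proof (rule act_generators[where ?x0.0 = x0 and x = x and j = j and B = B and M = M])
    show "a x0 dvd s" by (simp add: s_def)
    show "2 * M \<le> B" by (simp add: B_def)
      show "c (i, x0) = 0" for i by (rule c_out) (simp add: E_def)
    show "c (i, y) = 0" if "i < B" for i y using that by (intro c_out) (simp add: E_def)
    show "x \<in> ?X" "j < s - B" using jx(1) by (simp_all add: E_def)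
  qed (use x0 M jx(2) in simp_all)
  then obtain \<omega> where \<omega>: "\<omega> \<in> \<Omega>" "\<And>y. y \<in> free_gen ` {1, 2} \<Longrightarrow>
      \<exists>u\<in>carrier ?F. act u (\<omega>, \<one>\<^bsub>?F2\<^esub>) = (\<omega>, y)"
    by auto
  have fg: "finitely_generated G"
    unfolding assms(5) using R by (intro finitely_generated_presented_group) simp
  have "\<exists>H. subgroup H G \<and> finite (rcosets\<^bsub>G\<^esub> H) \<and> (\<exists>f. f \<in> epi (G\<lparr>carrier := H\<rparr>) ?F2)"
  proof (rule finite_index_epi_if_hom_wreath[OF G F2.is_group _ \<theta>(1) \<omega>(1) generate_free_gens])
    show "finite \<Omega>" by (simp add: \<Omega>_def)
    fix y :: "nat word" assume "y \<in> free_gen ` {1, 2}"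
    from \<omega>(2)[OF this] obtain u where "u \<in> carrier ?F" "act u (\<omega>, \<one>\<^bsub>?F2\<^esub>) = (\<omega>, y)" by blast
    then show "\<exists>g\<in>carrier G. \<theta> g (\<omega>, \<one>\<^bsub>?F2\<^esub>) = (\<omega>, y)"
      using \<theta>(2) by (intro bexI[of _ "presentation_map ?X R u"])
        (auto simp: assms(5) carrier_presented_group)
  qed
  with G fg show ?thesis unfolding large_def by blast
qed

end
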